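(* Let $n,d\geq 2$ and let $\mathbb{F}$ be an infinite field of characteristic $p>\frac{n}{2}$. Then $C_{n,d}<4\cdot 2^{n/2}d$. Moreover, if $n\geq 30$, then $C_{n,d}<2\cdot 2^{n/2}d$.
   Context: Let $\mathbb{F}$ be an infinite field of characteristic $p\geq 0$. Let $\mathcal{M}=\mathcal{M}(x_1,\ldots,x_d)$ be the free semigroup (without unity) generated by letters $x_1,\ldots,x_d$, and let $\mathcal{M}_{\mathbb{F}}$ be the vector space over $\mathbb{F}$ with basis $\mathcal{M}$, i.e. the free associative non-unital $\mathbb{F}$-algebra on $x_1,\ldots,x_d$. For $n\geq 1$ let $N_{n,d}=\mathcal{M}_{\mathbb{F}}/I_n$, where $I_n$ is the two-sided ideal of $\mathcal{M}_{\mathbb{F}}$ generated by all $f^n$, $f\in\mathcal{M}_{\mathbb{F}}$ (the relatively free algebra with identity $x^n=0$). The nilpotency degree is $C_{n,d}=\min\{c>0 \mid a_1\cdots a_c=0 \text{ for all } a_1,\ldots,a_c\in N_{n,d}\}$. It depends only on $n$, $d$ and $p$. *)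

theory Defs
  imports Complex_Main "HOL-Library.Poly_Mapping" "HOL-Library.Extended_Real"
    "HOL-Algebra.QuotRing"
begin

text \<open>
  Words under concatenation form a monoid, so that \<open>nat list \<Rightarrow>\<^sub>0 'k\<close>, with the
  convolution product of \<open>Poly_Mapping\<close>, is the free unital algebra over \<open>'k\<close> on
  the letters \<open>0, 1, 2, \<dots>\<close>. The free algebra without unity on \<open>d\<close> letters is the
  subspace spanned by the nonempty words in the letters \<open>0, \<dots>, d - 1\<close>.
\<close>

instantiation list :: (type) monoid_add
begin

definition zero_list :: "'a list" where "zero_list = []"

definition plus_list :: "'a list \<Rightarrow> 'a list \<Rightarrow> 'a list" where "plus_list u v = u @ v"

instance by standard (simp_all add: zero_list_def plus_list_def)

end

definition free_semigroup :: "nat \<Rightarrow> nat list set" where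
  "free_semigroup d = {w. w \<noteq> [] \<and> set w \<subseteq> {..<d}}"

definition free_algebra :: "nat \<Rightarrow> (nat list \<Rightarrow>\<^sub>0 'k::field) set" where
  "free_algebra d = {f. Poly_Mapping.keys f \<subseteq> free_semigroup d}"

definition two_sided_ideal :: "nat \<Rightarrow> (nat list \<Rightarrow>\<^sub>0 'k::field) set \<Rightarrow> bool" where
  "two_sided_ideal d I \<longleftrightarrow>
     I \<subseteq> free_algebra d \<and> 0 \<in> I \<and>
     (\<forall>f\<in>I. \<forall>g\<in>I. f + g \<in> I) \<and>
     (\<forall>c. \<forall>f\<in>I. Poly_Mapping.map ((*) c) f \<in> I) \<and>
     (\<forall>f\<in>I. \<forall>g\<in>free_algebra d. g * f \<in> I \<and> f * g \<in> I)"

definition nil_ideal :: "nat \<Rightarrow> nat \<Rightarrow> (nat list \<Rightarrow>\<^sub>0 'k::field) set" where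
  "nil_ideal n d = two_sided_ideal d hull {f ^ n |f. f \<in> free_algebra d}"

text \<open>
  The record type of rings demands a field \<open>one\<close>. The free algebra without unity has no
  such element: the value given here lies outside the carrier and is never used.
\<close>

definition free_ring :: "nat \<Rightarrow> (nat list \<Rightarrow>\<^sub>0 'k::field) ring" where
  "free_ring d =
     \<lparr>carrier = free_algebra d, mult = (*), one = 1, zero = 0, add = (+)\<rparr>"

definition rel_free_algebra :: "nat \<Rightarrow> nat \<Rightarrow> (nat list \<Rightarrow>\<^sub>0 'k::field) set ring" where
  "rel_free_algebra n d = free_ring d Quot nil_ideal n d"

text \<open>
  The nilpotency degree is an extended natural number: the infimum is the minimum if some
  \<open>c\<close> qualifies, and \<open>\<infinity>\<close> if the algebra is not nilpotent. A list \<open>as\<close> of length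
  \<open>c > 0\<close> is multiplied as \<open>as ! 0 \<otimes> \<dots> \<otimes> as ! (c - 1)\<close>, without use of \<open>one\<close>.
\<close>

definition nilpotency_degree :: "'k::field itself \<Rightarrow> nat \<Rightarrow> nat \<Rightarrow> enat" where
  "nilpotency_degree K n d =
     (let N = (rel_free_algebra n d :: (nat list \<Rightarrow>\<^sub>0 'k) set ring) in
      Inf (enat ` {c. c > 0 \<and>
        (\<forall>as. length as = c \<and> set as \<subseteq> carrier N \<longrightarrow>
              foldl (mult N) (hd as) (tl as) = zero N)}))"

end

theory Submission
  imports Defs "HOL-Combinatorics.Multiset_Permutations"
    "HOL-Computational_Algebra.Polynomial"
begin

text \<open>
  Fix a letter \<open>x\<close> and let the energy of a word be the sum of the squares of the lengths of its
  maximal runs of \<open>x\<close>. For \<open>k \<ge> 1\<close> and \<open>q = n div (k + 1)\<close>, the linearization of \<open>f ^ n = 0\<close> shows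
  that the sum of \<open>x\<^sup>k a\<^sub>\<sigma>\<^sub>1 x\<^sup>k \<dots> a\<^sub>\<sigma>\<^sub>q x\<^sup>k\<close> over all permutations \<open>\<sigma>\<close> vanishes modulo words of
  larger energy. So, for the product \<open>a * b = a x\<^sup>k b\<close> and modulo larger energy, the linearized
  identity \<open>a ^ q = 0\<close> holds, and \<open>q \<le> n div 2 < p\<close>: Higman's argument kills all words
  with \<open>2 ^ q\<close> runs of length \<open>k\<close>. By induction on the energy, a word is zero as soon as its degree
  in \<open>x\<close> exceeds \<open>\<Sum>k<n. k * (2 ^ (n div (k + 1)) - 1)\<close>; the term \<open>k = 1\<close> gives the order \<open>2 ^ (n div 2)\<close>.
\<close>

subsection \<open>Nagata--Higman for functions on words\<close>

lemma permutations_lessThanD: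
  assumes "s \<in> permutations_of_set {..<m}"
  shows "length s = m" "set s = {..<m}" "distinct s"
  using length_finite_permutations_of_set[OF assms] permutations_of_setD[OF assms] by simp_all

text \<open>Each permutation of \<open>{..<Suc q}\<close> arises exactly once by inserting
  \<open>q\<close> into a permutation of \<open>{..<q}\<close>; the inverse deletes \<open>q\<close>
  and records its position as the length of the prefix before it.\<close>

lemma sum_permutations_insert:
  "(\<Sum>xs\<in>permutations_of_set {..<Suc q}. f xs) =
     (\<Sum>xs\<in>permutations_of_set {..<q}. \<Sum>i\<le>q. f (take i xs @ q # drop i xs))"
proof -
  let ?S = "Sigma (permutations_of_set {..<q}) (\<lambda>_. {..q})"
  let ?ins = "\<lambda>(xs, i). take i xs @ q # drop i xs"
  let ?del = "\<lambda>xs. (removeAll q xs, length (takeWhile (\<lambda>y. y \<noteq> q) xs))"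
  have "bij_betw ?ins ?S (permutations_of_set {..<Suc q})"
  proof (rule bij_betw_byWitness[where f' = ?del])
    show "\<forall>p\<in>?S. ?del (?ins p) = p"
    proof
      fix p assume "p \<in> ?S"
      then obtain xs i where p: "p = (xs, i)" and xs: "xs \<in> permutations_of_set {..<q}" and i: "i \<le> q"
        by auto
      have q: "q \<notin> set xs" and len: "length xs = q"
        using permutations_lessThanD[OF xs] by auto
      then have "q \<notin> set (take i xs)" "q \<notin> set (drop i xs)"
        by (auto dest: in_set_takeD in_set_dropD)
      moreover from this have "takeWhile (\<lambda>y. y \<noteq> q) (take i xs @ q # drop i xs) = take i xs"
        by (subst takeWhile_append2) auto
      ultimately show "?del (?ins p) = p"
        using len i p by simp
    qed
    show "\<forall>xs\<in>permutations_of_set {..<Suc q}. ?ins (?del xs) = xs"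
    proof
      fix xs assume xs: "xs \<in> permutations_of_set {..<Suc q}"
      then have "q \<in> set xs" and d: "distinct xs" by (auto simp: permutations_of_set_def)
      then obtain ys zs where e: "xs = ys @ q # zs" by (meson split_list)
      with d have n: "q \<notin> set ys" "q \<notin> set zs" by auto
      have "takeWhile (\<lambda>y. y \<noteq> q) xs = ys" using n unfolding e by (subst takeWhile_append2) auto
      then show "?ins (?del xs) = xs" using n by (simp add: e)
    qed
    show "?ins ` ?S \<subseteq> permutations_of_set {..<Suc q}"
    proof (rule image_subsetI)
      fix p assume "p \<in> ?S"
      then obtain xs i where p: "p = (xs, i)" and xs: "xs \<in> permutations_of_set {..<q}" by auto
      then have "set (take i xs @ drop i xs) = {..<q}" "distinct (take i xs @ drop i xs)"
        by (auto simp: permutations_of_set_def)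
      then have "set (take i xs) \<union> set (drop i xs) = {..<q}" "set (take i xs) \<inter> set (drop i xs) = {}"
          "distinct (take i xs)" "distinct (drop i xs)"
        by (metis set_append, metis distinct_append, auto)
      then show "?ins p \<in> permutations_of_set {..<Suc q}"
        unfolding p by (auto simp: permutations_of_set_def lessThan_Suc)
    qed
    show "?del ` permutations_of_set {..<Suc q} \<subseteq> ?S"
    proof (rule image_subsetI)
      fix xs assume xs: "xs \<in> permutations_of_set {..<Suc q}"
      have del: "removeAll q xs \<in> permutations_of_set {..<q}"
        using permutations_lessThanD[OF xs]
        by (intro permutations_of_setI) (simp_all add: distinct_removeAll lessThan_Suc)
      have "q \<in> set xs" and len: "length xs = Suc q"
        using permutations_lessThanD[OF xs] by auto
      have "length (takeWhile (\<lambda>y. y \<noteq> q) xs) < length xs"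
        using \<open>q \<in> set xs\<close> by (metis (mono_tags, lifting) append_take_drop_id length_takeWhile_le le_neq_implies_less takeWhile_eq_all_conv takeWhile_eq_take take_all_iff order_refl)
      with len del show "?del xs \<in> ?S" by simp
    qed
  qed
  then have "(\<Sum>xs\<in>permutations_of_set {..<Suc q}. f xs) = (\<Sum>p\<in>?S. f (?ins p))"
    by (rule sum.reindex_bij_betw[symmetric])
  also have "\<dots> = (\<Sum>xs\<in>permutations_of_set {..<q}. \<Sum>i\<le>q. f (take i xs @ q # drop i xs))"
    by (subst sum.Sigma) (auto simp: split_beta)
  finally show ?thesis .
qed

section \<open>Vanishing of symmetrized products modulo a subgroup\<close>

definition add_subgroup_set :: "'v::ab_group_add set \<Rightarrow> bool" where
  "add_subgroup_set J \<longleftrightarrow> 0 \<in> J \<and> (\<forall>x\<in>J. \<forall>y\<in>J. x + y \<in> J) \<and> (\<forall>x\<in>J. - x \<in> J)"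

lemma add_subgroup_set_sum:
  assumes "add_subgroup_set J" "\<And>x. x \<in> S \<Longrightarrow> f x \<in> J"
  shows "sum f S \<in> J"
  using assms by (induction S rule: infinite_finite_induct) (auto simp: add_subgroup_set_def)

lemma add_subgroup_set_diff:
  assumes "add_subgroup_set J" "x \<in> J" "y \<in> J"
  shows "x - y \<in> J"
  using assms unfolding add_subgroup_set_def by (metis diff_conv_add_uminus)

lemma add_subgroup_set_cancel:
  assumes "add_subgroup_set J" "x + y \<in> J" "x \<in> J"
  shows "y \<in> J"
  using add_subgroup_set_diff[OF assms] by simp

text \<open>This is the full linearization of \<open>a ^ q = 0\<close>, with words evaluated by
  \<open>g\<close> and \<open>J\<close> in the role of zero. The contexts \<open>u\<close> and
  \<open>v\<close> make it usable inside longer words; the nonempty blocks reflect the absence of a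
  unit.\<close>

definition sym_vanish :: "('a list \<Rightarrow> 'v::ab_group_add) \<Rightarrow> 'v set \<Rightarrow> nat \<Rightarrow> bool" where
  "sym_vanish g J q \<longleftrightarrow> (\<forall>u v c. (\<forall>i<q. c i \<noteq> []) \<longrightarrow>
     (\<Sum>s\<in>permutations_of_set {..<q}. g (u @ concat (map c s) @ v)) \<in> J)"

lemma sym_vanishD:
  assumes "sym_vanish g J q" "\<And>i. i < q \<Longrightarrow> c i \<noteq> []"
  shows "(\<Sum>s\<in>permutations_of_set {..<q}. g (u @ concat (map c s) @ v)) \<in> J"
  using assms by (simp add: sym_vanish_def)

lemma sym_vanish_insert:
  assumes "sym_vanish g J (Suc m)" "\<And>i. i < m \<Longrightarrow> c i \<noteq> []" "z \<noteq> []"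
  shows "(\<Sum>s\<in>permutations_of_set {..<m}. \<Sum>i\<le>m.
           g (u @ concat (map c (take i s)) @ z @ concat (map c (drop i s)) @ v)) \<in> J"
proof -
  let ?c = "c(m := z)"
  have "(\<Sum>s\<in>permutations_of_set {..<Suc m}. g (u @ concat (map ?c s) @ v)) \<in> J"
    by (rule sym_vanishD[OF assms(1)]) (use assms in auto)
  also have "(\<Sum>s\<in>permutations_of_set {..<Suc m}. g (u @ concat (map ?c s) @ v)) =
     (\<Sum>s\<in>permutations_of_set {..<m}. \<Sum>i\<le>m.
        g (u @ concat (map ?c (take i s @ m # drop i s)) @ v))"
    by (rule sum_permutations_insert)
  also have "\<dots> = (\<Sum>s\<in>permutations_of_set {..<m}. \<Sum>i\<le>m.
           g (u @ concat (map c (take i s)) @ z @ concat (map c (drop i s)) @ v))"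
  proof (intro sum.cong refl)
    fix s i assume "s \<in> permutations_of_set {..<m}"
    then have "m \<notin> set s" using permutations_lessThanD by fastforce
    then have "m \<notin> set (take i s)" "m \<notin> set (drop i s)" by (meson in_set_takeD in_set_dropD)+
    then have "map ?c (take i s) = map c (take i s)" "map ?c (drop i s) = map c (drop i s)"
      by (auto intro!: map_cong)
    then show "g (u @ concat (map ?c (take i s @ m # drop i s)) @ v) =
       g (u @ concat (map c (take i s)) @ z @ concat (map c (drop i s)) @ v)"
      by (simp del: map_eq_conv map_fun_upd)
  qed
  finally show ?thesis .
qed

text \<open>
  Higman's double sum: the words of \<open>E\<close> below are summed once over the insertions of
  \<open>z b\<^sub>1 \<dots> b\<^sub>j\<close> into the product of the \<open>a\<close>s, and once over the insertions of
  a tail of that product into the product of the \<open>b\<close>s; the empty tail, which cannot be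
  used as a factor, gives the same word \<open>m + 1\<close> times.
\<close>

lemma sym_vanish_sandwich:
  fixes g :: "'a list \<Rightarrow> 'v::ab_group_add"
  assumes J: "add_subgroup_set J" and g: "sym_vanish g J (Suc m)"
    and div: "\<And>w::'v. (\<Sum>i\<le>m. w) \<in> J \<Longrightarrow> w \<in> J"
    and a: "\<And>i. i < m \<Longrightarrow> a i \<noteq> []" and b: "\<And>i. i < m \<Longrightarrow> b i \<noteq> []" and z: "z \<noteq> []"
  shows "(\<Sum>s\<in>permutations_of_set {..<m}. \<Sum>t\<in>permutations_of_set {..<m}.
           g (u @ concat (map a s) @ z @ concat (map b t) @ v)) \<in> J"
proof -
  let ?P = "permutations_of_set {..<m}"
  let ?A = "\<lambda>s. concat (map a s)" and ?B = "\<lambda>s. concat (map b s)"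
  define E where "E s t i j = g (u @ ?A (take i s) @ z @ ?B (take j t) @ ?A (drop i s) @ ?B (drop j t) @ v)"
    for s t i j
  define F where "F s t = g (u @ ?A s @ z @ ?B t @ v)" for s t
  have 1: "(\<Sum>s\<in>?P. \<Sum>i\<le>m. E s t i j) \<in> J" for t j
    using sym_vanish_insert[OF g a, where z = "z @ ?B (take j t)" and u = u and v = "?B (drop j t) @ v"] z
    by (simp add: E_def)
  have 2: "(\<Sum>t\<in>?P. \<Sum>j\<le>m. E s t i j) \<in> J" if "i < m" "s \<in> ?P" for s i
  proof -
    have "drop i s \<noteq> []" using that permutations_lessThanD[of s m] by simp
    moreover have "\<And>k. k \<in> set (drop i s) \<Longrightarrow> a k \<noteq> []"
      using a that permutations_lessThanD[of s m] by (metis in_set_dropD lessThan_iff)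
    ultimately have "?A (drop i s) \<noteq> []" by (cases "drop i s") auto
    then show ?thesis
      using sym_vanish_insert[OF g b, where z = "?A (drop i s)" and u = "u @ ?A (take i s) @ z" and v = v]
      by (simp add: E_def)
  qed
  have "(\<Sum>t\<in>?P. \<Sum>j\<le>m. \<Sum>s\<in>?P. \<Sum>i\<le>m. E s t i j) \<in> J"
    by (intro add_subgroup_set_sum[OF J] 1)
  also have "(\<Sum>t\<in>?P. \<Sum>j\<le>m. \<Sum>s\<in>?P. \<Sum>i\<le>m. E s t i j) =
      (\<Sum>t\<in>?P. \<Sum>s\<in>?P. \<Sum>j\<le>m. \<Sum>i\<le>m. E s t i j)"
    by (intro sum.cong refl sum.swap)
  also have "\<dots> = (\<Sum>s\<in>?P. \<Sum>t\<in>?P. \<Sum>i\<le>m. \<Sum>j\<le>m. E s t i j)"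
    by (subst sum.swap, intro sum.cong refl sum.swap)
  also have "\<dots> = (\<Sum>s\<in>?P. \<Sum>i\<le>m. \<Sum>t\<in>?P. \<Sum>j\<le>m. E s t i j)"
    by (intro sum.cong refl sum.swap)
  also have "\<dots> = (\<Sum>s\<in>?P. (\<Sum>i<m. \<Sum>t\<in>?P. \<Sum>j\<le>m. E s t i j) + (\<Sum>t\<in>?P. \<Sum>j\<le>m. E s t m j))"
    by (simp add: lessThan_Suc_atMost[symmetric])
  also have "\<dots> = (\<Sum>s\<in>?P. \<Sum>i<m. \<Sum>t\<in>?P. \<Sum>j\<le>m. E s t i j) + (\<Sum>s\<in>?P. \<Sum>t\<in>?P. \<Sum>j\<le>m. E s t m j)"
    by (simp add: sum.distrib)
  finally have "(\<Sum>s\<in>?P. \<Sum>i<m. \<Sum>t\<in>?P. \<Sum>j\<le>m. E s t i j) + (\<Sum>s\<in>?P. \<Sum>t\<in>?P. \<Sum>j\<le>m. E s t m j) \<in> J" .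
  moreover have "(\<Sum>s\<in>?P. \<Sum>i<m. \<Sum>t\<in>?P. \<Sum>j\<le>m. E s t i j) \<in> J"
    by (intro add_subgroup_set_sum[OF J] 2) auto
  ultimately have "(\<Sum>s\<in>?P. \<Sum>t\<in>?P. \<Sum>j\<le>m. E s t m j) \<in> J"
    by (rule add_subgroup_set_cancel[OF J])
  also have "(\<Sum>s\<in>?P. \<Sum>t\<in>?P. \<Sum>j\<le>m. E s t m j) = (\<Sum>s\<in>?P. \<Sum>t\<in>?P. \<Sum>j\<le>m. F s t)"
  proof (intro sum.cong refl)
    fix s t j assume "s \<in> ?P"
    then have "length s = m" by (rule permutations_lessThanD)
    moreover have "?B (take j t) @ ?B (drop j t) = ?B t"
      by (metis append_take_drop_id concat_append map_append)
    ultimately show "E s t m j = F s t"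
      by (simp add: E_def F_def flip: append_assoc)
  qed
  also have "\<dots> = (\<Sum>s\<in>?P. \<Sum>j\<le>m. \<Sum>t\<in>?P. F s t)"
    by (intro sum.cong refl sum.swap)
  also have "\<dots> = (\<Sum>j\<le>m. \<Sum>s\<in>?P. \<Sum>t\<in>?P. F s t)"
    by (rule sum.swap)
  finally show ?thesis using div by (simp add: F_def)
qed

text \<open>The bound comes from the recursion \<open>L (m + 1) = 2 * L m + 1\<close>: the word is
  cut at a middle letter, and the sandwich identity lets the induction hypothesis be applied to each
  half in turn. The hypothesis \<open>div\<close> says that the integers from 1 to \<open>q\<close>
  can be cancelled modulo \<open>J\<close>.\<close>

lemma nagata_higman:
  fixes g :: "'a list \<Rightarrow> 'v::ab_group_add"
  assumes J: "add_subgroup_set J" and g: "sym_vanish g J q"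
    and div: "\<And>r w::'v. r < q \<Longrightarrow> (\<Sum>i\<le>r. w) \<in> J \<Longrightarrow> w \<in> J"
    and w: "length w \<ge> 2 ^ q - 1"
  shows "g w \<in> J"
  using g div w
proof (induction q arbitrary: g w)
  case 0
  then show ?case using sym_vanishD[OF 0(1), of "\<lambda>_. []" w "[]"] by simp
next
  case (Suc m)
  let ?P = "permutations_of_set {..<m}"
  define k :: nat where "k = 2 ^ m - 1"
  have "(1::nat) \<le> 2 ^ m" by simp
  then have "2 ^ Suc m - 1 = Suc (k + k)" unfolding k_def power_Suc by linarith
  with Suc.prems have len: "length w \<ge> Suc (k + k)" by simp
  define w1 w2 where "w1 = take k w" and "w2 = drop (Suc k) w"
  have w: "w = w1 @ [w ! k] @ w2" using len by (simp add: w1_def w2_def id_take_nth_drop)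
  have l: "length w1 \<ge> 2 ^ m - 1" "length w2 \<ge> 2 ^ m - 1"
    using len by (auto simp: w1_def w2_def k_def)
  have div: "\<And>r w::'v. r < m \<Longrightarrow> (\<Sum>i\<le>r. w) \<in> J \<Longrightarrow> w \<in> J"
    using Suc.prems(2) less_SucI by blast
  have 1: "(\<Sum>t\<in>?P. g (w1 @ z @ concat (map b t) @ v)) \<in> J"
    if b: "\<And>i. i < m \<Longrightarrow> b i \<noteq> []" and z: "z \<noteq> []" for b v z
  proof -
    \<comment> \<open>With the right-hand blocks fixed, the sandwich identity is a linearized
      identity for the left-hand word; the right context \<open>v'\<close> of that word is absorbed
      into \<open>z\<close>.\<close>
    have "sym_vanish (\<lambda>x. \<Sum>t\<in>?P. g (x @ z @ concat (map b t) @ v)) J m"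
      unfolding sym_vanish_def
    proof (intro allI impI)
      fix u v' and a :: "nat \<Rightarrow> 'a list" assume a: "\<forall>i<m. a i \<noteq> []"
      show "(\<Sum>s\<in>?P. \<Sum>t\<in>?P. g ((u @ concat (map a s) @ v') @ z @ concat (map b t) @ v)) \<in> J"
        using sym_vanish_sandwich[OF J Suc.prems(1) Suc.prems(2)[OF lessI], where a = a and b = b and z = "v' @ z" and u = u and v = v] a b z by simp
    qed
    from Suc.IH[OF this div l(1)] show ?thesis by simp
  qed
  \<comment> \<open>The left half is now the fixed word \<open>w1\<close>. The middle letter
    supplies a nonempty \<open>z\<close> even when the context \<open>u\<close> is empty.\<close>
  have "sym_vanish (\<lambda>x. g (w1 @ [w ! k] @ x)) J m"
    unfolding sym_vanish_def
  proof (intro allI impI)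
    fix u v and b :: "nat \<Rightarrow> 'a list" assume "\<forall>i<m. b i \<noteq> []"
    then show "(\<Sum>s\<in>?P. g (w1 @ [w ! k] @ u @ concat (map b s) @ v)) \<in> J"
      using 1[of b "[w ! k] @ u" v] by simp
  qed
  from Suc.IH[OF this div l(2)] w show ?case by simp
qed

subsection \<open>Runs of a letter\<close>

text \<open>Empty runs are listed too: a word with \<open>s\<close> letters other than
  \<open>x\<close> has \<open>s + 1\<close> entries, one for each gap.\<close>

fun runs :: "'a \<Rightarrow> 'a list \<Rightarrow> nat list" where
  "runs x [] = [0]"
| "runs x (c # w) = (if c = x then Suc (hd (runs x w)) # tl (runs x w) else 0 # runs x w)"

lemma runs_nonempty [simp]: "runs x w \<noteq> []"
  by (cases w) auto

lemma runs_append_Cons: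
  assumes "c \<noteq> x"
  shows "runs x (u @ c # v) = runs x u @ runs x v"
  using assms by (induction u) auto

lemma runs_replicate [simp]: "runs x (replicate i x) = [i]"
  by (induction i) auto

lemma runs_replicate_Cons:
  assumes "c \<noteq> x"
  shows "runs x (replicate i x @ c # v) = i # runs x v"
  using runs_append_Cons[OF assms, of "replicate i x" v] by simp

lemma sum_list_runs: "sum_list (runs x w) = count_list w x"
proof (induction w)
  case (Cons c w)
  then show ?case by (cases "runs x w") auto
qed simp

lemma run_induct [case_names replicate append]:
  assumes "\<And>i. P (replicate i x)"
    and "\<And>i c w. c \<noteq> x \<Longrightarrow> P w \<Longrightarrow> P (replicate i x @ c # w)"
  shows "P w"
proof (induction w rule: length_induct)
  case (1 w)
  show ?case
  proof (cases "dropWhile (\<lambda>y. y = x) w")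
    case Nil
    then have "w = replicate (length w) x"
      by (intro replicate_eqI) (auto simp: dropWhile_eq_Nil_conv)
    then show ?thesis using assms(1)[of "length w"] by simp
  next
    case (Cons c w')
    then have c: "c \<noteq> x" using hd_dropWhile[of "\<lambda>y. y = x" w] by auto
    define i where "i = length (takeWhile (\<lambda>y. y = x) w)"
    have "takeWhile (\<lambda>y. y = x) w = replicate i x"
      unfolding i_def by (intro replicate_eqI) (auto dest: set_takeWhileD)
    then have w: "w = replicate i x @ c # w'"
      using takeWhile_dropWhile_id[of "\<lambda>y. y = x" w] Cons by simp
    have "length w' < length w" unfolding w by simp
    with 1 have "P w'" by blast
    then show ?thesis unfolding w by (rule assms(2)[OF c])
  qed
qed

definition run_energy :: "'a \<Rightarrow> 'a list \<Rightarrow> nat" where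
  "run_energy x w = sum_list (map (\<lambda>i. i\<^sup>2) (runs x w))"

lemma run_energy_Nil [simp]: "run_energy x [] = 0"
  by (simp add: run_energy_def)

lemma run_energy_replicate [simp]: "run_energy x (replicate i x) = i\<^sup>2"
  by (simp add: run_energy_def)

lemma run_energy_append_Cons:
  assumes "c \<noteq> x"
  shows "run_energy x (u @ c # v) = run_energy x u + run_energy x v"
  by (simp add: run_energy_def runs_append_Cons[OF assms])

text \<open>Additivity can only fail if a run crosses the seam, which an empty factor or a bordering
  letter other than \<open>x\<close> excludes.\<close>

lemma run_energy_append:
  assumes "u = [] \<or> v = [] \<or> last u \<noteq> x \<or> hd v \<noteq> x"
  shows "run_energy x (u @ v) = run_energy x u + run_energy x v"
proof -
  consider "u = []" | "v = []" | "u \<noteq> []" "last u \<noteq> x" | "v \<noteq> []" "hd v \<noteq> x"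
    using assms by blast
  then show ?thesis
  proof cases
    case 3
    then obtain u' c where u: "u = u' @ [c]" "c \<noteq> x" by (metis append_butlast_last_id)
    then show ?thesis
      using run_energy_append_Cons[OF u(2), of u' v] run_energy_append_Cons[OF u(2), of u' "[]"] by simp
  next
    case 4
    then obtain v' c where v: "v = c # v'" "c \<noteq> x" by (cases v) auto
    then show ?thesis
      using run_energy_append_Cons[OF v(2), of u v'] run_energy_append_Cons[OF v(2), of "[]" v'] by simp
  qed auto
qed

text \<open>A sum of squares of natural numbers is at most the square of the sum. Since
  rearrangements keep the length, increasing the energy is a terminating process.\<close>

lemma run_energy_le: "run_energy x w \<le> (length w)\<^sup>2"
proof -
  have "sum_list (map (\<lambda>i. i\<^sup>2) l) \<le> (sum_list l)\<^sup>2" for l :: "nat list"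
    by (induction l) (auto simp: power2_eq_square algebra_simps)
  then have "run_energy x w \<le> (count_list w x)\<^sup>2"
    by (metis run_energy_def sum_list_runs)
  also have "\<dots> \<le> (length w)\<^sup>2" by (simp add: count_le_length power_mono)
  finally show ?thesis .
qed

text \<open>
  \<open>2 k z - k\<^sup>2 (s + 1)\<close> is the sum of \<open>2 k i - k\<^sup>2\<close> over the \<open>s + 1\<close> runs of length
  \<open>i\<close>, and \<open>i\<^sup>2\<close> exceeds its tangent at \<open>k\<close> unless \<open>i = k\<close>.
\<close>

lemma run_energy_tangent:
  fixes k :: nat
  defines "bal \<equiv> \<lambda>x w. replicate k x @ concat (map (\<lambda>c. c # replicate k x) (filter (\<lambda>c. c \<noteq> x) w))"
  shows "2 * k * count_list w x \<le> run_energy x w + k\<^sup>2 * Suc (length (filter (\<lambda>c. c \<noteq> x) w))"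
    and "2 * k * count_list w x = run_energy x w + k\<^sup>2 * Suc (length (filter (\<lambda>c. c \<noteq> x) w)) \<Longrightarrow>
           w = bal x w"
proof -
  have tangent: "2 * k * i \<le> i\<^sup>2 + k\<^sup>2" "2 * k * i = i\<^sup>2 + k\<^sup>2 \<Longrightarrow> i = k" for i
  proof -
    have "int (i\<^sup>2 + k\<^sup>2) - int (2 * k * i) = (int i - int k)\<^sup>2"
      by (simp add: power2_eq_square algebra_simps)
    moreover have "(int i - int k)\<^sup>2 \<ge> 0" by simp
    ultimately show "2 * k * i \<le> i\<^sup>2 + k\<^sup>2" by linarith
    show "i = k" if "2 * k * i = i\<^sup>2 + k\<^sup>2"
    proof -
      have "(int i - int k)\<^sup>2 = 0" using that \<open>_ = (int i - int k)\<^sup>2\<close> by linarith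
      then show ?thesis by simp
    qed
  qed
  have [simp]: "count_list (replicate i x) x = i" "filter (\<lambda>c. c \<noteq> x) (replicate i x) = []" for i
    by (induction i) auto
  have "2 * k * count_list w x \<le> run_energy x w + k\<^sup>2 * Suc (length (filter (\<lambda>c. c \<noteq> x) w)) \<and>
     (2 * k * count_list w x = run_energy x w + k\<^sup>2 * Suc (length (filter (\<lambda>c. c \<noteq> x) w)) \<longrightarrow> w = bal x w)"
  proof (induction w rule: run_induct[where x = x])
    case (replicate i)
    show ?case using tangent[of i] by (auto simp: bal_def)
  next
    case (append i c w)
    have "bal x (replicate i x @ c # w) = replicate k x @ c # bal x w"
      using append by (simp add: bal_def)
    moreover have "run_energy x (replicate i x @ c # w) = i\<^sup>2 + run_energy x w"
      using append by (simp add: run_energy_append_Cons)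
    ultimately show ?case using append tangent[of i]
      by (auto simp: algebra_simps)
  qed
  then show "2 * k * count_list w x \<le> run_energy x w + k\<^sup>2 * Suc (length (filter (\<lambda>c. c \<noteq> x) w))"
    and "2 * k * count_list w x = run_energy x w + k\<^sup>2 * Suc (length (filter (\<lambda>c. c \<noteq> x) w)) \<Longrightarrow> w = bal x w"
    by auto
qed

text \<open>Blocks of this form can separate runs of \<open>x\<close> without changing their
  lengths.\<close>

definition inner_word :: "'a \<Rightarrow> 'a list \<Rightarrow> bool" where
  "inner_word x b \<longleftrightarrow> b \<noteq> [] \<and> hd b \<noteq> x \<and> last b \<noteq> x"

text \<open>Runs of the placeholder \<open>y\<close> become runs of \<open>x\<close> of the same
  length, and all further runs of \<open>x\<close> lie inside single blocks. The share of the blocks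
  depends only on the content of \<open>w\<close>, so rearrangements can be compared by their energy
  in \<open>y\<close> alone.\<close>

lemma run_energy_concat:
  assumes "\<And>c. c \<in> set w \<Longrightarrow> c \<noteq> y \<Longrightarrow> inner_word x (g c)" "g y = [x]"
  shows "run_energy x (concat (map g w)) =
     run_energy y w + sum_list (map (\<lambda>c. if c = y then 0 else run_energy x (g c)) w)"
  using assms
proof (induction w rule: run_induct[where x = y])
  case (replicate i)
  have "concat (map g (replicate i y)) = replicate i x" using replicate by (induction i) auto
  moreover have "sum_list (map (\<lambda>c. if c = y then 0 else run_energy x (g c)) (replicate i y)) = 0"
    by (induction i) auto
  ultimately show ?case by simp
next
  case (append i c w)
  have r: "concat (map g (replicate i y)) = replicate i x" using append by (induction i) auto
  have s: "sum_list (map (\<lambda>c. if c = y then 0 else run_energy x (g c)) (replicate i y)) = 0"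
    by (induction i) auto
  have c: "inner_word x (g c)" using append by auto
  have "run_energy x (concat (map g (replicate i y @ c # w))) =
      run_energy x (replicate i x @ g c @ concat (map g w))" by (simp add: r del: map_replicate)
  also have "\<dots> = i\<^sup>2 + run_energy x (g c) + run_energy x (concat (map g w))"
    using c by (auto simp: run_energy_append inner_word_def)
  finally show ?case
    using append s by (simp add: run_energy_append_Cons)
qed

text \<open>Only runs of the exact length \<open>k\<close> are separated; other powers of \<open>x\<close> stay inside the \<open>bs\<close>.\<close>

lemma runs_split:
  assumes "count_list (runs x w) k = Suc m"
  shows "\<exists>u bs v. w = u @ replicate k x @ concat (map (\<lambda>b. b @ replicate k x) bs) @ v \<and>
     length bs = m \<and> (\<forall>b\<in>set bs. inner_word x b) \<and> (u = [] \<or> last u \<noteq> x) \<and> (v = [] \<or> hd v \<noteq> x)"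
  using assms
proof (induction w arbitrary: m rule: run_induct[where x = x])
  case (replicate i)
  then have "i = k" "m = 0" by (auto split: if_splits)
  then have "replicate i x = [] @ replicate k x @ concat (map (\<lambda>b. b @ replicate k x) []) @ []"
    by simp
  then show ?case using \<open>m = 0\<close> by (metis list.size(3) empty_iff empty_set)
next
  case (append i c w)
  from append(1,3) have r: "count_list (i # runs x w) k = Suc m"
    by (simp add: runs_replicate_Cons)
  show ?case
  proof (cases "i = k")
    case False
    with r append.IH obtain u bs v where
      "w = u @ replicate k x @ concat (map (\<lambda>b. b @ replicate k x) bs) @ v"
      "length bs = m" "\<forall>b\<in>set bs. inner_word x b" "u = [] \<or> last u \<noteq> x" "v = [] \<or> hd v \<noteq> x"
      by auto
    then show ?thesis using append(1)
      by (intro exI[of _ "replicate i x @ c # u"] exI[of _ bs] exI[of _ v]) auto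
  next
    case True
    show ?thesis
    proof (cases m)
      case 0
      then show ?thesis using append(1) True
        by (intro exI[of _ "[]"] exI[of _ "c # w"]) auto
    next
      case (Suc m')
      with r True append.IH obtain u bs v where
        w: "w = u @ replicate k x @ concat (map (\<lambda>b. b @ replicate k x) bs) @ v"
        "length bs = m'" "\<forall>b\<in>set bs. inner_word x b" "u = [] \<or> last u \<noteq> x" "v = [] \<or> hd v \<noteq> x"
        by auto
      then show ?thesis using append(1) True Suc
        by (intro exI[of _ "[]"] exI[of _ "(c # u) # bs"] exI[of _ v]) (auto simp: inner_word_def)
    qed
  qed
qed

subsection \<open>The degree bound\<close>

text \<open>
  A word with \<open>2 ^ (n div (k + 1))\<close> or more runs of \<open>x\<close> of the same length \<open>k\<close> can be reduced,
  so an irreducible word has degree at most \<open>exponent_bound n\<close> in \<open>x\<close>.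
\<close>

definition exponent_bound :: "nat \<Rightarrow> nat" where
  "exponent_bound n = (\<Sum>k<n. k * (2 ^ (n div (k + 1)) - 1))"

lemma exponent_bound_upt:
  assumes "n \<ge> 2"
  shows "exponent_bound n =
    2 ^ (n div 2) - 1 + sum_list (map (\<lambda>k. k * (2 ^ (n div (k + 1)) - 1)) [2..<n])"
proof -
  have "{..<n} = {0, 1} \<union> {2..<n}" using assms by auto
  then show ?thesis
    unfolding exponent_bound_def
    by (simp add: sum.union_disjoint interv_sum_list_conv_sum_set_nat flip: numeral_2_eq_2)
qed

text \<open>Squaring keeps the comparison with \<open>2 powr (n / 2)\<close> within the natural
  numbers, for odd \<open>n\<close> as well. The estimate for large \<open>n\<close> leaves finitely
  many cases, which are evaluated.\<close>

lemma exponent_bound_small_aux: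
  "list_all (\<lambda>n. (exponent_bound n + 1)\<^sup>2 \<le> 16 * 2 ^ n) [2..<30]"
  "list_all (\<lambda>n. (exponent_bound n + 1)\<^sup>2 \<le> 4 * 2 ^ n) [30..<48]"
  by (simp_all add: exponent_bound_upt power2_eq_square)

text \<open>The term \<open>k = 1\<close> is below \<open>2 ^ (n div 2)\<close>. The term
  \<open>k = 2\<close> is of order \<open>2 ^ (n div 3)\<close>, and all later exponents are at most
  \<open>n div 4\<close>; each of these two parts is at most half of
  \<open>2 ^ (n div 2)\<close>.\<close>

lemma exponent_bound_large:
  assumes "n \<ge> 48"
  shows "exponent_bound n + 1 \<le> 2 * 2 ^ (n div 2)"
proof -
  define a where "a = n div 4"
  have a: "n \<le> 4 * a + 3" "2 * a \<le> n div 2" "a \<ge> 12" "n div 3 + 2 \<le> n div 2"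
    using assms by (auto simp: a_def)
  \<comment> \<open>The estimate fails at \<open>b = 11\<close>, where
    \<open>47 ^ 2 > 2 ^ 11\<close>; the start at \<open>b = 12\<close> corresponds to
    \<open>n \<ge> 48\<close>.\<close>
  have sq: "(4 * b + 3)\<^sup>2 \<le> 2 ^ b" if "b \<ge> 12" for b :: nat
    using that
  proof (induction b rule: dec_induct)
    case base
    show ?case by simp
  next
    case (step b)
    have "(4 * Suc b + 3)\<^sup>2 \<le> 2 * (4 * b + 3)\<^sup>2"
      using step(1) by (simp add: power2_eq_square algebra_simps) (use mult_le_mono1[OF step(1), of b] in linarith)
    then show ?case using step by simp
  qed
  have sum: "2 * (\<Sum>k=1..<m. k) \<le> m\<^sup>2" for m :: nat
    by (induction m) (auto simp: power2_eq_square)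
  have "{..<n} = {0, 1, 2} \<union> {3..<n}" using assms by auto
  then have "exponent_bound n =
      (2 ^ (n div 2) - 1) + 2 * (2 ^ (n div 3) - 1) + (\<Sum>k=3..<n. k * (2 ^ (n div (k + 1)) - 1))"
    unfolding exponent_bound_def by (simp add: sum.union_disjoint flip: numeral_2_eq_2, use one_le_power[of "2::nat" "n div 2"] in linarith)
  moreover have "(\<Sum>k=3..<n. k * (2 ^ (n div (k + 1)) - 1)) \<le> (\<Sum>k=3..<n. k * 2 ^ a)"
  proof (intro sum_mono mult_left_mono)
    fix k assume "k \<in> {3..<n}"
    then have "n div (k + 1) \<le> a" unfolding a_def by (intro div_le_mono2) auto
    then show "2 ^ (n div (k + 1)) - 1 \<le> (2::nat) ^ a"
      by (meson diff_le_self le_trans power_increasing one_le_numeral)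
  qed simp
  moreover have "(\<Sum>k=3..<n. k * 2 ^ a) = (\<Sum>k=3..<n. k) * (2::nat) ^ a"
    by (simp add: sum_distrib_right)
  moreover have "2 * (\<Sum>k=3..<n. k) \<le> 2 ^ a"
  proof -
    have "(\<Sum>k=3..<n. k) \<le> (\<Sum>k=1..<n. k)" by (rule sum_mono2) auto
    then have "2 * (\<Sum>k=3..<n. k) \<le> n\<^sup>2" using sum[of n] by linarith
    also have "\<dots> \<le> (4 * a + 3)\<^sup>2" using a by (intro power_mono) auto
    also have "\<dots> \<le> 2 ^ a" using sq a by blast
    finally show ?thesis .
  qed
  then have "2 * ((\<Sum>k=3..<n. k) * 2 ^ a) \<le> 2 ^ a * 2 ^ a"
    using mult_le_mono1[of _ _ "2 ^ a"] by (simp add: mult.assoc)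
  moreover have "(2::nat) ^ a * 2 ^ a \<le> 2 ^ (n div 2)"
    using power_increasing[OF a(2), of "2::nat"] by (simp add: mult_2 power_add)
  moreover have "4 * 2 ^ (n div 3) \<le> (2::nat) ^ (n div 2)"
    using power_increasing[OF a(4), of "2::nat"] by (simp add: power_add)
  moreover have "(1::nat) \<le> 2 ^ (n div 2)" "(1::nat) \<le> 2 ^ (n div 3)" by simp_all
  ultimately show ?thesis by linarith
qed

lemma exponent_bound_square:
  shows "n \<ge> 2 \<Longrightarrow> (exponent_bound n + 1)\<^sup>2 \<le> 16 * 2 ^ n"
    and "n \<ge> 30 \<Longrightarrow> (exponent_bound n + 1)\<^sup>2 \<le> 4 * 2 ^ n"
proof -
  show 4: "(exponent_bound n + 1)\<^sup>2 \<le> 4 * 2 ^ n" if "n \<ge> 30"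
  proof (cases "n < 48")
    case True
    then show ?thesis using exponent_bound_small_aux(2)[unfolded list_all_iff set_upt] that by auto
  next
    case False
    then have "(exponent_bound n + 1)\<^sup>2 \<le> (2 * 2 ^ (n div 2))\<^sup>2"
      by (intro power_mono exponent_bound_large) auto
    also have "\<dots> = 4 * 2 ^ (2 * (n div 2))" by (simp add: power_mult_distrib flip: power_mult)
    also have "\<dots> \<le> 4 * 2 ^ n" by simp
    finally show ?thesis .
  qed
  show "(exponent_bound n + 1)\<^sup>2 \<le> 16 * 2 ^ n" if "n \<ge> 2"
  proof (cases "n < 30")
    case True
    then show ?thesis using exponent_bound_small_aux(1)[unfolded list_all_iff set_upt] that by auto
  next
    case False
    then have "(exponent_bound n + 1)\<^sup>2 \<le> 4 * 2 ^ n" using 4 by simp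
    also have "\<dots> \<le> 16 * 2 ^ n" by simp
    finally show ?thesis .
  qed
qed

text \<open>After taking square roots, strictness comes from \<open>d * D + 1 < d * D + d\<close>,
  which holds for \<open>d \<ge> 2\<close>.\<close>

lemma less_powr_half:
  fixes n d C D :: nat
  assumes "(D + 1)\<^sup>2 \<le> C\<^sup>2 * 2 ^ n" "d \<ge> 2" 
  shows "real (d * D + 1) < real C * 2 powr (real n / 2) * real d"
proof -
  have "real (D + 1) \<le> real C * 2 powr (real n / 2)"
  proof (rule power2_le_imp_le)
    have "(2 powr (real n / 2))\<^sup>2 = (2::real) ^ n"
      by (simp add: power2_eq_square powr_realpow flip: powr_add)
    then have "(real C * 2 powr (real n / 2))\<^sup>2 = real (C\<^sup>2 * 2 ^ n)"
      by (simp add: power_mult_distrib)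
    then show "(real (D + 1))\<^sup>2 \<le> (real C * 2 powr (real n / 2))\<^sup>2"
      using of_nat_mono[OF assms(1), where 'a = real] by simp
  qed simp
  then have "real (D + 1) * real d \<le> real C * 2 powr (real n / 2) * real d"
    by (rule mult_right_mono) simp
  moreover have "real (d * D + 1) < real (D + 1) * real d" using assms(2) by (simp add: algebra_simps)
  ultimately show ?thesis by linarith
qed

subsection \<open>Linearization\<close>

text \<open>Any nonroot of the product of \<open>x\<close> and all \<open>x ^ j - 1\<close> with
  \<open>1 \<le> j \<le> m\<close> will do: for \<open>s \<noteq> 0\<close>, an equality
  \<open>s ^ i = s ^ m\<close> would give \<open>s ^ (m - i) = 1\<close>.\<close>

lemma infinite_field_power_separation:
  assumes "infinite (UNIV :: 'k::field set)"
  obtains s :: "'k::field" where "s \<noteq> 0" "\<And>i. i < m \<Longrightarrow> s ^ i \<noteq> s ^ m"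
proof -
  define p :: "'k poly" where "p = monom 1 1 * (\<Prod>j=1..m. monom 1 j - 1)"
  have "monom 1 j - 1 \<noteq> (0 :: 'k poly)" if "j \<ge> 1" for j
  proof
    assume "monom 1 j - 1 = (0 :: 'k poly)"
    then have "degree (monom 1 j :: 'k poly) = degree (1 :: 'k poly)" by simp
    with that show False by (simp add: degree_monom_eq)
  qed
  then have "p \<noteq> 0" by (auto simp: p_def)
  then have "finite {s. poly p s = 0}" by (rule poly_roots_finite)
  with assms obtain s where s: "poly p s \<noteq> 0"
    by (metis (mono_tags, lifting) UNIV_eq_I mem_Collect_eq)
  show ?thesis
  proof (rule that)
    show s0: "s \<noteq> 0" using s by (auto simp: p_def poly_monom)
    show "s ^ i \<noteq> s ^ m" if "i < m" for i
    proof
      assume e: "s ^ i = s ^ m"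
      have "s ^ m = s ^ i * s ^ (m - i)" using that by (simp flip: power_add)
      with e s0 have "s ^ (m - i) = 1" by simp
      moreover have "m - i \<in> {1..m}" using that by auto
      ultimately have "poly p s = 0" by (auto simp: p_def poly_prod poly_monom)
      with s show False by simp
    qed
  qed
qed

lemma power_sum_eq_sum_words:
  fixes h :: "'b \<Rightarrow> 'a::semiring_1"
  assumes "finite B"
  shows "(\<Sum>b\<in>B. h b) ^ n = (\<Sum>w\<in>{w. set w \<subseteq> B \<and> length w = n}. prod_list (map h w))"
proof (induction n)
  case 0
  have "{w. set w \<subseteq> B \<and> w = []} = {[]}" by auto
  then show ?case by simp
next
  case (Suc n)
  let ?W = "{w. set w \<subseteq> B \<and> length w = n}"
  have "(\<Sum>w\<in>{w. set w \<subseteq> B \<and> length w = Suc n}. prod_list (map h w)) =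
      (\<Sum>(w, b)\<in>?W \<times> B. h b * prod_list (map h w))"
    unfolding lists_length_Suc_eq
    by (subst sum.reindex) (auto simp: inj_on_def case_prod_unfold)
  also have "\<dots> = (\<Sum>w\<in>?W. \<Sum>b\<in>B. h b * prod_list (map h w))"
    by (rule sum.cartesian_product[symmetric])
  also have "\<dots> = (\<Sum>b\<in>B. h b) * (\<Sum>w\<in>?W. prod_list (map h w))"
    by (subst sum.swap) (simp add: sum_product)
  finally show ?case using Suc by simp
qed

section \<open>Balanced words and the minimality of their energy\<close>

definition balanced :: "nat \<Rightarrow> 'a \<Rightarrow> 'a list \<Rightarrow> 'a list" where
  "balanced k x s = replicate k x @ concat (map (\<lambda>c. c # replicate k x) s)"

lemma balanced_simps:
  "balanced k x [] = replicate k x"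
  "balanced k x (c # s) = replicate k x @ c # balanced k x s"
  by (simp_all add: balanced_def)

lemma length_balanced: "length (balanced k x s) = k + (k + 1) * length s"
  by (induction s) (simp_all add: balanced_simps)

lemma count_list_replicate: "count_list (replicate k y) x = (if x = y then k else 0)"
  by (induction k) auto

lemma count_list_balanced:
  "count_list (balanced k x s) b = count_list s b + (if b = x then k * Suc (length s) else 0)"
  by (induction s) (auto simp: balanced_simps count_list_replicate)

lemma filter_balanced: "x \<notin> set s \<Longrightarrow> filter (\<lambda>c. c \<noteq> x) (balanced k x s) = s"
  by (induction s) (auto simp: balanced_simps)

lemma run_energy_balanced:
  "x \<notin> set s \<Longrightarrow> run_energy x (balanced k x s) = k\<^sup>2 * Suc (length s)"
  by (induction s) (auto simp: balanced_simps run_energy_append_Cons)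

lemma concat_map_balanced:
  assumes "\<And>c. c \<in> set s \<Longrightarrow> g c = a c" "g y = [x]"
  shows "concat (map g (balanced k y s)) = replicate k x @ concat (map (\<lambda>c. a c @ replicate k x) s)"
proof -
  have r: "concat (map g (replicate k y)) = replicate k x" using assms(2) by (induction k) auto
  show ?thesis using assms(1) by (induction s) (auto simp: balanced_simps r simp del: map_replicate)
qed

text \<open>The content of \<open>w\<close> forces the mean gap length to be \<open>k\<close>. Hence
  the tangent inequality at \<open>k\<close>, summed over the gaps, compares the energy with that of
  a balanced word, and equality forces every gap to have length \<open>k\<close>.\<close>

lemma run_energy_gt_balanced:
  assumes "y \<notin> set s" "mset w = mset (balanced k y s)"
  shows "w = balanced k y (filter (\<lambda>c. c \<noteq> y) w) \<or> run_energy y w > run_energy y (balanced k y s)"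
proof -
  have "mset (filter (\<lambda>c. c \<noteq> y) w) = mset s"
    using assms filter_balanced[OF assms(1), of k] by (metis mset_filter)
  then have l: "length (filter (\<lambda>c. c \<noteq> y) w) = length s" by (metis size_mset)
  have "count_list w y = count_list (balanced k y s) y"
    using assms(2) by (metis count_mset)
  also have "\<dots> = k * Suc (length s)"
    using assms(1) by (simp add: count_list_balanced count_list_0_iff)
  finally have c: "2 * k * count_list w y = k\<^sup>2 * Suc (length s) + k\<^sup>2 * Suc (length s)"
    by (simp add: power2_eq_square algebra_simps)
  note tangent = run_energy_tangent[where k = k and w = w and x = y, folded balanced_def, unfolded l]
  show ?thesis
  proof (cases "2 * k * count_list w y = run_energy y w + k\<^sup>2 * Suc (length s)")
    case True
    then show ?thesis using tangent(2) by blast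
  next
    case False
    with tangent(1) have "2 * k * count_list w y < run_energy y w + k\<^sup>2 * Suc (length s)"
      by linarith
    then have "run_energy y (balanced k y s) < run_energy y w"
      unfolding c run_energy_balanced[OF assms(1)] by simp
    then show ?thesis ..
  qed
qed

text \<open>This translates permutations into multidegrees, by which the components of a power are
  selected.\<close>

lemma permutations_lessThan_iff_count:
  fixes s :: "nat list"
  shows "s \<in> permutations_of_set {..<q} \<longleftrightarrow> (\<forall>b. count_list s b = (if b < q then 1 else 0))"
proof
  assume "s \<in> permutations_of_set {..<q}"
  then have "set s = {..<q}" "distinct s" using permutations_lessThanD[of s q] by simp_all
  then show "\<forall>b. count_list s b = (if b < q then 1 else 0)"
    by (metis count_mset distinct_count_atmost_1 lessThan_iff)
next
  assume c: "\<forall>b. count_list s b = (if b < q then 1 else 0)"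
  then have "set s = {..<q}" by (metis count_list_0_iff lessThan_iff zero_neq_one subsetI subset_antisym)
  moreover have "distinct s" unfolding distinct_count_atmost_1 count_mset
    using c calculation by simp
  ultimately show "s \<in> permutations_of_set {..<q}" by (rule permutations_of_setI)
qed

section \<open>Monomials and scalars\<close>

abbreviation word_monomial :: "'a list \<Rightarrow> 'a list \<Rightarrow>\<^sub>0 'k::field" where
  "word_monomial w \<equiv> Poly_Mapping.single w 1"

lemma single_mult_word: "Poly_Mapping.single u a * Poly_Mapping.single v b = Poly_Mapping.single (u @ v) (a * b)"
  by (simp add: mult_single plus_list_def)

text \<open>Here \<open>0\<close> is the empty word, so \<open>Poly_Mapping.single 0 c\<close> acts
  as the scalar \<open>c\<close>.\<close>

lemma single_scalar_mult [simp]: "Poly_Mapping.single 0 c * Poly_Mapping.single w b = Poly_Mapping.single w (c * b)"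
  by (simp add: mult_single)

lemma single_Nil: "Poly_Mapping.single [] 1 = 1"
  by (metis single_one zero_list_def)

lemma scalar_assoc:
  "Poly_Mapping.single 0 a * (Poly_Mapping.single 0 b * f) = Poly_Mapping.single 0 (a * b) * f"
  for f :: "'a list \<Rightarrow>\<^sub>0 'k::field"
  by (simp flip: mult.assoc)

lemma prod_list_single:
  "prod_list (map (\<lambda>b. Poly_Mapping.single (\<gamma> b) (t b)) w) =
     Poly_Mapping.single (concat (map \<gamma> w)) (prod_list (map t w) :: 'k::field)"
  by (induction w) (simp_all add: single_mult_word single_Nil)

text \<open>Membership in \<open>J\<close> stands for vanishing in the quotient. The reductions work
  for any ideal that contains the \<open>n\<close>-th powers; \<open>nil_ideal\<close> enters as an
  instance.\<close>

locale nil_quotient =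
  fixes n d :: nat and J :: "(nat list \<Rightarrow>\<^sub>0 'k::field) set"
  assumes ideal: "two_sided_ideal d J"
    and power_mem: "f \<in> free_algebra d \<Longrightarrow> f ^ n \<in> J"
    and infinite_field: "infinite (UNIV :: 'k set)"
begin

lemma scalar_mem: "f \<in> J \<Longrightarrow> Poly_Mapping.single 0 c * f \<in> J"
  using ideal unfolding two_sided_ideal_def mult_map_scale_conv_mult by blast

lemma scalar_memD:
  assumes "Poly_Mapping.single 0 c * f \<in> J" "c \<noteq> 0"
  shows "f \<in> J"
proof -
  have "Poly_Mapping.single 0 (inverse c) * (Poly_Mapping.single 0 c * f) \<in> J"
    by (rule scalar_mem[OF assms(1)])
  then show ?thesis using assms(2) by (simp add: scalar_assoc)
qed

lemma add_subgroup_J: "add_subgroup_set J"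
proof -
  have "- f \<in> J" if "f \<in> J" for f
    using scalar_mem[OF that, of "-1"] by (simp add: single_uminus)
  then show ?thesis using ideal unfolding two_sided_ideal_def add_subgroup_set_def by blast
qed

lemmas zero_mem = add_subgroup_J[unfolded add_subgroup_set_def, THEN conjunct1]
lemmas sum_mem = add_subgroup_set_sum[OF add_subgroup_J]
lemmas diff_mem = add_subgroup_set_diff[OF add_subgroup_J]

text \<open>An ideal absorbs multipliers from the algebra without unity; the empty word acts as the
  unit and is treated separately, so that contexts may be empty.\<close>

lemma word_mult_mem:
  assumes "f \<in> J" "set u \<subseteq> {..<d}"
  shows "word_monomial u * f \<in> J" "f * word_monomial u \<in> J"
proof -
  have "word_monomial u * f \<in> J \<and> f * word_monomial u \<in> J"
  proof (cases "u = []")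
    case True
    then show ?thesis using assms(1) by (simp add: single_Nil)
  next
    case False
    then have "word_monomial u \<in> (free_algebra d :: (nat list \<Rightarrow>\<^sub>0 'k) set)"
      using assms(2) by (simp add: free_algebra_def free_semigroup_def)
    then show ?thesis using ideal assms(1) unfolding two_sided_ideal_def by blast
  qed
  then show "word_monomial u * f \<in> J" "f * word_monomial u \<in> J" by auto
qed

text \<open>Subtracting \<open>s ^ Suc m\<close> times the value at \<open>t\<close> from the value
  at \<open>s * t\<close> eliminates the top coefficient and multiplies the others by
  \<open>s ^ i - s ^ Suc m\<close>, which is nonzero by the choice of \<open>s\<close>. This
  replaces the inversion of a Vandermonde matrix.\<close>

lemma coefficient_mem:
  assumes "\<And>t. (\<Sum>i\<le>m. Poly_Mapping.single 0 (t ^ i) * c i) \<in> J" "i \<le> m"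
  shows "c i \<in> J"
  using assms
proof (induction m arbitrary: c i)
  case 0
  then show ?case using "0.prems"(1)[of 1] by simp
next
  case (Suc m)
  let ?S = "\<lambda>a. Poly_Mapping.single (0 :: nat list) (a :: 'k)"
  obtain s :: 'k where s: "s \<noteq> 0" "\<And>i. i < Suc m \<Longrightarrow> s ^ i \<noteq> s ^ Suc m"
    using infinite_field_power_separation[OF infinite_field] by blast
  have "(\<Sum>i\<le>m. ?S (t ^ i) * (?S (s ^ i - s ^ Suc m) * c i)) \<in> J" for t
  proof -
    have "(\<Sum>i\<le>Suc m. ?S ((s * t) ^ i) * c i) - ?S (s ^ Suc m) * (\<Sum>i\<le>Suc m. ?S (t ^ i) * c i) \<in> J"
      by (intro diff_mem scalar_mem Suc.prems(1))
    also have "(\<Sum>i\<le>Suc m. ?S ((s * t) ^ i) * c i) - ?S (s ^ Suc m) * (\<Sum>i\<le>Suc m. ?S (t ^ i) * c i) =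
       (\<Sum>i\<le>Suc m. ?S ((s * t) ^ i - s ^ Suc m * t ^ i) * c i)"
      by (simp only: sum_distrib_left scalar_assoc flip: sum_subtractf)
        (simp only: left_diff_distrib single_diff)
    also have "\<dots> = (\<Sum>i\<le>m. ?S ((s * t) ^ i - s ^ Suc m * t ^ i) * c i)"
      by (simp add: power_mult_distrib)
    also have "\<dots> = (\<Sum>i\<le>m. ?S (t ^ i) * (?S (s ^ i - s ^ Suc m) * c i))"
      by (intro sum.cong refl) (simp add: scalar_assoc power_mult_distrib right_diff_distrib mult_ac)
    finally show ?thesis .
  qed
  from Suc.IH[OF this] have le: "c i \<in> J" if "i \<le> m" for i
    using scalar_memD s(2) that by (metis le_imp_less_Suc right_minus_eq)
  \<comment> \<open>The top coefficient is recovered from the value at \<open>t = 1\<close>.\<close>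
  have "(\<Sum>i\<le>m. c i) \<in> J" by (intro sum_mem le) simp
  from diff_mem[OF Suc.prems(1)[of 1] this] have "c (Suc m) \<in> J" by simp
  with le Suc.prems(2) show ?case by (cases "i = Suc m") auto
qed

text \<open>Scaling the parameter of the letter \<open>b\<close> by \<open>s\<close> multiplies the
  term of \<open>w\<close> by \<open>s ^ count_list w b\<close>, so the terms of degree
  \<open>j\<close> in \<open>b\<close> form the coefficient of \<open>s ^ j\<close>.\<close>

lemma homogeneous_component_mem:
  assumes W: "finite W"
    and t: "\<And>t :: nat \<Rightarrow> 'k. (\<Sum>w\<in>W. Poly_Mapping.single 0 (prod_list (map t w)) * G w) \<in> J"
  shows "(\<Sum>w | w \<in> W \<and> count_list w b = j. Poly_Mapping.single 0 (prod_list (map t w)) * G w) \<in> J"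
proof -
  let ?S = "\<lambda>a. Poly_Mapping.single (0 :: nat list) (a :: 'k)"
  let ?c = "\<lambda>j. \<Sum>w | w \<in> W \<and> count_list w b = j. ?S (prod_list (map t w)) * G w"
  define m where "m = Max (insert j ((\<lambda>w. count_list w b) ` W))"
  have m: "count_list w b \<le> m" if "w \<in> W" for w using that W by (simp add: m_def)
  have j: "j \<le> m" using W by (simp add: m_def)
  have "(\<Sum>i\<le>m. ?S (s ^ i) * ?c i) \<in> J" for s
  proof -
    define t' where "t' = t(b := s * t b)"
    have t': "prod_list (map t' w) = s ^ count_list w b * prod_list (map t w)" for w
      by (induction w) (auto simp: t'_def)
    have "(\<Sum>w\<in>W. ?S (prod_list (map t' w)) * G w) =
        (\<Sum>i\<le>m. \<Sum>w | w \<in> W \<and> count_list w b = i. ?S (prod_list (map t' w)) * G w)"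
      using W m by (intro sum.group[symmetric]) auto
    also have "\<dots> = (\<Sum>i\<le>m. ?S (s ^ i) * ?c i)"
      by (intro sum.cong refl) (simp add: t' sum_distrib_left scalar_assoc)
    finally show ?thesis using t[of t'] by simp
  qed
  then show ?thesis using j by (rule coefficient_mem)
qed

text \<open>One letter is treated at a time. The parameters \<open>t\<close> stay arbitrary during
  the induction, as every further letter varies them, and are set to 1 only at the end.\<close>

lemma multihomogeneous_component_mem:
  assumes "finite W" "finite B"
    and "\<And>t :: nat \<Rightarrow> 'k. (\<Sum>w\<in>W. Poly_Mapping.single 0 (prod_list (map t w)) * G w) \<in> J"
  shows "(\<Sum>w | w \<in> W \<and> (\<forall>b\<in>B. count_list w b = e b). G w) \<in> J"
proof -
  have "(\<Sum>w | w \<in> W \<and> (\<forall>b\<in>B. count_list w b = e b). Poly_Mapping.single 0 (prod_list (map t w)) * G w) \<in> J"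
    for t
    using assms(2)
  proof (induction B arbitrary: t)
    case empty
    then show ?case using assms(3) by simp
  next
    case (insert b B)
    have "(\<Sum>w | w \<in> {w \<in> W. \<forall>b\<in>B. count_list w b = e b} \<and> count_list w b = e b.
        Poly_Mapping.single 0 (prod_list (map t w)) * G w) \<in> J"
      by (intro homogeneous_component_mem insert.IH) (use assms(1) in auto)
    then show ?case by (simp add: conj_ac)
  qed
  from this[of "\<lambda>_. 1"] have "(\<Sum>w | w \<in> W \<and> (\<forall>b\<in>B. count_list w b = e b).
      Poly_Mapping.single 0 (prod_list (map (\<lambda>_. 1) w)) * G w) \<in> J" .
  moreover have "prod_list (map (\<lambda>_. 1 :: 'k) w) = 1" for w :: "nat list" by (induction w) auto
  ultimately show ?thesis by simp
qed

text \<open>The \<open>n\<close>-th power of a generic combination of the \<open>\<gamma> b\<close>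
  expands into words over \<open>B\<close>, each occurring once. Extracting the component of
  multidegree \<open>e\<close> therefore requires no inverse of a factorial.\<close>

lemma linearized_power_mem:
  fixes B :: "nat set"
  assumes B: "finite B" and \<gamma>: "\<And>b. b \<in> B \<Longrightarrow> \<gamma> b \<in> free_semigroup d"
  shows "(\<Sum>w | (set w \<subseteq> B \<and> length w = n) \<and> (\<forall>b\<in>B. count_list w b = e b).
           word_monomial (concat (map \<gamma> w))) \<in> J"
proof -
  have "(\<Sum>w | w \<in> {w. set w \<subseteq> B \<and> length w = n} \<and> (\<forall>b\<in>B. count_list w b = e b).
           word_monomial (concat (map \<gamma> w))) \<in> J"
  proof (rule multihomogeneous_component_mem[OF finite_lists_length_eq[OF B] B])
    fix t :: "nat \<Rightarrow> 'k"
    have "Poly_Mapping.keys (\<Sum>b\<in>B. Poly_Mapping.single (\<gamma> b) (t b)) \<subseteq> free_semigroup d"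
      using \<gamma> by (intro order_trans[OF keys_sum]) (auto split: if_splits)
    then have "(\<Sum>b\<in>B. Poly_Mapping.single (\<gamma> b) (t b)) ^ n \<in> J"
      by (intro power_mem) (simp add: free_algebra_def)
    then show "(\<Sum>w | set w \<subseteq> B \<and> length w = n. Poly_Mapping.single 0 (prod_list (map t w)) *
        word_monomial (concat (map \<gamma> w))) \<in> J"
      by (simp add: power_sum_eq_sum_words[OF B] prod_list_single)
  qed
  then show ?thesis by simp
qed

end

subsection \<open>Reduction of words\<close>

lemma mset_concat_map_cong:
  assumes "mset w = mset w'"
  shows "mset (concat (map g w)) = mset (concat (map g w'))"
proof -
  have "mset (concat (map g v)) = sum_mset (image_mset (\<lambda>c. mset (g c)) (mset v))" for v
    by (induction v) simp_all
  then show ?thesis using assms by metis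
qed

lemma sum_list_map_cong_mset:
  fixes h :: "'a \<Rightarrow> nat"
  assumes "mset w = mset w'"
  shows "sum_list (map h w) = sum_list (map h w')"
  using assms by (metis mset_map sum_mset_sum_list)

lemma run_energy_pattern:
  assumes "u = [] \<or> last u \<noteq> x" "v = [] \<or> hd v \<noteq> x" "\<And>b. b \<in> set bs \<Longrightarrow> inner_word x b"
  shows "run_energy x (u @ replicate k x @ concat (map (\<lambda>b. b @ replicate k x) bs) @ v) =
     run_energy x u + k\<^sup>2 + sum_list (map (\<lambda>b. run_energy x b + k\<^sup>2) bs) + run_energy x v"
proof -
  have "run_energy x (replicate k x @ concat (map (\<lambda>b. b @ replicate k x) bs) @ v) =
     k\<^sup>2 + sum_list (map (\<lambda>b. run_energy x b + k\<^sup>2) bs) + run_energy x v"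
    using assms(3)
  proof (induction bs)
    case Nil
    then show ?case using assms(2) by (auto simp: run_energy_append)
  next
    case (Cons b bs)
    then have b: "inner_word x b" by simp
    let ?r = "replicate k x @ concat (map (\<lambda>b. b @ replicate k x) bs) @ v"
    have "run_energy x (replicate k x @ b @ ?r) = k\<^sup>2 + run_energy x (b @ ?r)"
      using b by (subst run_energy_append) (auto simp: inner_word_def)
    also have "run_energy x (b @ ?r) = run_energy x b + run_energy x ?r"
      using b by (subst run_energy_append) (auto simp: inner_word_def)
    finally show ?case using Cons by simp
  qed
  moreover have "run_energy x (u @ replicate k x @ concat (map (\<lambda>b. b @ replicate k x) bs) @ v) =
      run_energy x u + run_energy x (replicate k x @ concat (map (\<lambda>b. b @ replicate k x) bs) @ v)"
    using assms(1) by (subst run_energy_append) auto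
  ultimately show ?thesis by simp
qed

text \<open>With the padding moved in front of the blocks, a nonempty left context ends in a block
  instead of a run of \<open>x\<close>.\<close>

lemma concat_map_replicate_shift:
  "replicate k x @ concat (map (\<lambda>b. b @ replicate k x) u) = concat (map (\<lambda>b. replicate k x @ b) u) @ replicate k x"
  by (induction u) auto

text \<open>Blocks joined by \<open>x ^ k\<close> form one block again, since its first and last
  letters come from the outer blocks. This makes nonempty products of blocks admissible
  factors.\<close>

lemma inner_block:
  assumes "cs \<noteq> []" "\<And>b. b \<in> set cs \<Longrightarrow> inner_word x b"
  obtains a where "inner_word x a" "concat (map (\<lambda>b. b @ replicate k x) cs) = a @ replicate k x"
proof -
  from assms(1) have cs: "cs = butlast cs @ [last cs]" by simp
  define a where "a = concat (map (\<lambda>b. b @ replicate k x) (butlast cs)) @ last cs"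
  have "concat (map (\<lambda>b. b @ replicate k x) cs) = a @ replicate k x"
    unfolding a_def by (subst cs) simp
  moreover have l: "inner_word x (last cs)" using assms by simp
  have "inner_word x a"
  proof (cases "butlast cs")
    case Nil
    then show ?thesis using l by (simp add: a_def)
  next
    case (Cons b bs)
    then have "inner_word x b" using assms(2) by (metis in_set_butlastD list.set_intros(1))
    then show ?thesis using l Cons by (auto simp: a_def inner_word_def)
  qed
  ultimately show ?thesis by (rule that[rotated])
qed

context nil_quotient
begin

text \<open>
  The component of \<open>(x + a\<^sub>1 + \<dots> + a\<^sub>q) ^ n\<close> that is linear in every \<open>a\<^sub>i\<close>, multiplied by
  \<open>x ^ (k - n mod (k + 1))\<close>, has \<open>(q + 1) k\<close> letters \<open>x\<close> for its \<open>q + 1\<close> gaps; all words that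
  do not put \<open>k\<close> of them in each gap have larger energy. The letter \<open>q\<close> stands for \<open>x\<close> below.
\<close>

lemma balanced_sum_mem:
  assumes k: "q = n div (k + 1)" and x: "x < d"
    and a: "\<And>i. i < q \<Longrightarrow> inner_word x (a i)" "\<And>i. i < q \<Longrightarrow> set (a i) \<subseteq> {..<d}"
    and u: "set u \<subseteq> {..<d}" "u = [] \<or> last u \<noteq> x"
    and v: "set v \<subseteq> {..<d}" "v = [] \<or> hd v \<noteq> x"
    and s0: "s0 \<in> permutations_of_set {..<q}"
    and w0: "w0 = u @ replicate k x @ concat (map (\<lambda>i. a i @ replicate k x) s0) @ v"
    and IH: "\<And>w. mset w = mset w0 \<Longrightarrow> run_energy x w > run_energy x w0 \<Longrightarrow> word_monomial w \<in> J"
  shows "(\<Sum>s\<in>permutations_of_set {..<q}.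
           word_monomial (u @ replicate k x @ concat (map (\<lambda>i. a i @ replicate k x) s) @ v)) \<in> J"
proof -
  define r where "r = n mod (k + 1)"
  have r: "r \<le> k" by (simp add: r_def flip: less_Suc_eq_le)
  have n: "n = r + q * (k + 1)" unfolding r_def k by (rule mod_div_mult_eq[symmetric])
  define \<gamma> where "\<gamma> i = (if i < q then a i else [x])" for i
  \<comment> \<open>As \<open>n = r + q * (k + 1)\<close>, degree 1 in each of the \<open>q\<close>
    block letters leaves degree \<open>r + q * k\<close> for the letter \<open>q\<close>.\<close>
  define e where "e i = (if i < q then 1 else r + q * k)" for i
  define S where "S = {w. (set w \<subseteq> {..q} \<and> length w = n) \<and> (\<forall>b\<in>{..q}. count_list w b = e b)}"
  define lift where "lift w = u @ concat (map \<gamma> (replicate (k - r) q @ w)) @ v" for w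
  \<comment> \<open>\<open>T\<close> collects the words that become balanced after padding; all
    words of \<open>S - T\<close> gain energy. In \<open>tail s\<close> the first gap has only
    \<open>r\<close> letters, since \<open>lift\<close> prepends the other
    \<open>k - r\<close>.\<close>
  define T where "T = {w \<in> S. replicate (k - r) q @ w = balanced k q (filter (\<lambda>c. c \<noteq> q) w)}"
  define tail where "tail s = replicate r q @ concat (map (\<lambda>c. c # replicate k q) s)" for s
  have perm: "set s = {..<q}" "length s = q" "q \<notin> set s" if "s \<in> permutations_of_set {..<q}" for s
    using permutations_lessThanD[OF that] by auto
  have \<gamma>_replicate: "concat (map \<gamma> (replicate i q)) = replicate i x" for i
    by (induction i) (auto simp: \<gamma>_def)
  have lift_balanced: "u @ concat (map \<gamma> (balanced k q s)) @ v =
      u @ replicate k x @ concat (map (\<lambda>i. a i @ replicate k x) s) @ v"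
    if "s \<in> permutations_of_set {..<q}" for s
    using perm[OF that] by (subst concat_map_balanced[where a = a and x = x]) (auto simp: \<gamma>_def)
  have tail: "replicate (k - r) q @ tail s = balanced k q s" for s
    using r by (simp add: tail_def balanced_def flip: append_assoc replicate_add)
  have finite: "finite S" unfolding S_def
    by (rule finite_subset[OF _ finite_lists_length_eq[of "{..q}" n]]) auto
  have "(\<Sum>w\<in>S. word_monomial (concat (map \<gamma> w))) \<in> J"
    unfolding S_def
  proof (rule linearized_power_mem)
    show "\<gamma> b \<in> free_semigroup d" if "b \<in> {..q}" for b
      using a x by (auto simp: \<gamma>_def free_semigroup_def inner_word_def)
  qed simp
  then have "word_monomial (u @ replicate (k - r) x) * (\<Sum>w\<in>S. word_monomial (concat (map \<gamma> w))) * word_monomial v \<in> J"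
    using u v x by (intro word_mult_mem) (auto simp: set_replicate_conv_if)
  then have lift_S: "(\<Sum>w\<in>S. word_monomial (lift w)) \<in> J"
    by (simp add: sum_distrib_left sum_distrib_right single_mult_word lift_def \<gamma>_replicate del: map_replicate)
  have mset_S: "mset (replicate (k - r) q @ w) = mset (balanced k q s)"
    if "w \<in> S" "s \<in> permutations_of_set {..<q}" for w s
  proof (rule multiset_eqI)
    fix b
    have "count_list w b = (if b \<le> q then e b else 0)"
      using that(1) by (auto simp: S_def count_list_0_iff)
    moreover have "count_list s b = (if b < q then 1 else 0)"
      using that(2) permutations_lessThan_iff_count by blast
    ultimately show "count (mset (replicate (k - r) q @ w)) b = count (mset (balanced k q s)) b"
      using r perm(2)[OF that(2)]
      by (auto simp: count_mset count_list_balanced count_list_replicate e_def algebra_simps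
          simp del: mset_append mset_replicate)
  qed
  have "word_monomial (lift w) \<in> J" if w: "w \<in> S - T" for w
  proof (rule IH)
    let ?w = "replicate (k - r) q @ w"
    have m: "mset ?w = mset (balanced k q s0)" using w mset_S s0 by blast
    then show "mset (lift w) = mset w0"
      unfolding lift_def w0 lift_balanced[OF s0, symmetric]
      using mset_concat_map_cong[OF m, of \<gamma>] by simp
    \<comment> \<open>Contexts and blocks contribute equally for all words of the same content,
      which reduces the comparison to \<open>run_energy q\<close>.\<close>
    have energy: "run_energy x (u @ concat (map \<gamma> z) @ v) = run_energy x u + run_energy q z +
        sum_list (map (\<lambda>c. if c = q then 0 else run_energy x (\<gamma> c)) z) + run_energy x v"
      if "set z \<subseteq> {..q}" for z
    proof -
      have "run_energy x (concat (map \<gamma> z)) =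
          run_energy q z + sum_list (map (\<lambda>c. if c = q then 0 else run_energy x (\<gamma> c)) z)"
        using that a(1) by (intro run_energy_concat) (force simp: \<gamma>_def)+
      then show ?thesis
        using u(2) v(2) by (subst run_energy_append, force)+ simp
    qed
    have "filter (\<lambda>c. c \<noteq> q) ?w = filter (\<lambda>c. c \<noteq> q) w" by simp
    then have "run_energy q ?w > run_energy q (balanced k q s0)"
      using run_energy_gt_balanced[OF perm(3)[OF s0] m] w unfolding T_def by auto
    moreover have "set ?w \<subseteq> {..q}" using w by (auto simp: S_def set_replicate_conv_if)
    moreover from this have "set (balanced k q s0) \<subseteq> {..q}" using m by (metis set_mset_mset)
    ultimately show "run_energy x (lift w) > run_energy x w0"
      unfolding lift_def w0 lift_balanced[OF s0, symmetric]
      using energy[of ?w] energy[of "balanced k q s0"]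
        sum_list_map_cong_mset[OF m, of "\<lambda>c. if c = q then 0 else run_energy x (\<gamma> c)"]
      by linarith
  qed
  then have "(\<Sum>w\<in>S - T. word_monomial (lift w)) \<in> J" by (rule sum_mem)
  moreover have "T \<subseteq> S" by (auto simp: T_def)
  then have "(\<Sum>w\<in>S. word_monomial (lift w)) =
      (\<Sum>w\<in>S - T. word_monomial (lift w)) + (\<Sum>w\<in>T. word_monomial (lift w) :: nat list \<Rightarrow>\<^sub>0 'k)"
    using finite by (rule sum.subset_diff)
  ultimately have "(\<Sum>w\<in>T. word_monomial (lift w)) \<in> J"
    using lift_S add_subgroup_set_cancel[OF add_subgroup_J] by metis
  also have "(\<Sum>w\<in>T. word_monomial (lift w)) = (\<Sum>s\<in>permutations_of_set {..<q}.
           word_monomial (u @ replicate k x @ concat (map (\<lambda>i. a i @ replicate k x) s) @ v) :: nat list \<Rightarrow>\<^sub>0 'k)"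
  proof (rule sum.reindex_bij_witness[where j = "filter (\<lambda>c. c \<noteq> q)" and i = tail])
    fix w assume w: "w \<in> T"
    let ?s = "filter (\<lambda>c. c \<noteq> q) w"
    have b: "replicate (k - r) q @ w = balanced k q ?s" using w by (simp add: T_def)
    have "replicate (k - r) q @ tail ?s = replicate (k - r) q @ w" unfolding tail b ..
    then show "tail ?s = w" by (simp only: same_append_eq)
    have "count_list ?s c = (if c < q then 1 else 0)" for c
    proof -
      have "count_list ?s c = (if c = q then 0 else count_list w c)"
        by (induction w) auto
      moreover have "c > q \<Longrightarrow> count_list w c = 0"
        using w by (auto simp: T_def S_def count_list_0_iff)
      ultimately show ?thesis using w by (auto simp: T_def S_def e_def)
    qed
    then show s: "?s \<in> permutations_of_set {..<q}" by (simp add: permutations_lessThan_iff_count)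
    show "word_monomial (u @ replicate k x @ concat (map (\<lambda>i. a i @ replicate k x) ?s) @ v) =
       (word_monomial (lift w) :: nat list \<Rightarrow>\<^sub>0 'k)"
      unfolding lift_def b lift_balanced[OF s] ..
  next
    fix s assume s: "s \<in> permutations_of_set {..<q}"
    have "filter (\<lambda>c. c \<noteq> q) (replicate (k - r) q @ tail s) = s"
      unfolding tail by (rule filter_balanced[OF perm(3)[OF s]])
    then have f: "filter (\<lambda>c. c \<noteq> q) (tail s) = s" by simp
    then show "filter (\<lambda>c. c \<noteq> q) (tail s) = s" .
    have "length (replicate (k - r) q @ tail s) = k + (k + 1) * q"
      unfolding tail by (simp add: length_balanced perm[OF s])
    then have "length (tail s) = n" using r n by (simp add: mult.commute)
    moreover have count: "count_list (tail s) b = (if b < q then 1 else if b = q then r + q * k else 0)" for b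
    proof -
      have "count_list (replicate (k - r) q @ tail s) b = count_list s b + (if b = q then k * Suc q else 0)"
        unfolding tail by (simp add: count_list_balanced perm[OF s])
      moreover have "count_list s b = (if b < q then 1 else 0)"
        using s permutations_lessThan_iff_count by blast
      ultimately show ?thesis using r by (auto simp: count_list_replicate algebra_simps split: if_splits)
    qed
    moreover have "set (tail s) \<subseteq> {..q}"
    proof
      fix b assume "b \<in> set (tail s)"
      then have "count_list (tail s) b \<noteq> 0" by (simp add: count_list_0_iff)
      then show "b \<in> {..q}" unfolding count by (simp split: if_splits)
    qed
    ultimately show "tail s \<in> T" by (auto simp: T_def S_def e_def f tail)
  qed
  finally show ?thesis .
qed

end

section \<open>Repeated runs and induction on the energy\<close>

lemma set_concat_padded:
  "set (concat (map (\<lambda>b. b @ replicate k x) bs)) \<subseteq> insert x (\<Union>b\<in>set bs. set b)"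
  "set (concat (map (\<lambda>b. replicate k x @ b) bs)) \<subseteq> insert x (\<Union>b\<in>set bs. set b)"
  by (induction bs) auto

text \<open>If every length \<open>k \<ge> 1\<close> occurred at most
  \<open>2 ^ (n div (k + 1)) - 1\<close> times, weighting by \<open>k\<close> and summing would
  bound the degree by \<open>exponent_bound n\<close>.\<close>

lemma exists_repeated_run:
  assumes "count_list w x > exponent_bound n"
  shows "\<exists>k\<ge>1. count_list (runs x w) k \<ge> 2 ^ (n div (k + 1))"
proof (rule ccontr)
  assume "\<not> ?thesis"
  then have less: "count_list (runs x w) k \<le> 2 ^ (n div (k + 1)) - 1" if "k \<ge> 1" for k
    using that by (metis One_nat_def Suc_pred less_Suc_eq_le not_le zero_less_numeral zero_less_power)
  have bound: "k * count_list (runs x w) k \<le> k * (2 ^ (n div (k + 1)) - 1)" for k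
    using less[of k] by (cases "k = 0") auto
  have "count_list w x = (\<Sum>k\<in>set (runs x w). count_list (runs x w) k * k)"
    using sum_list_map_eq_sum_count[of id "runs x w"] by (simp add: sum_list_runs)
  also have "\<dots> = (\<Sum>k\<in>set (runs x w) \<inter> {..<n}. count_list (runs x w) k * k)"
  proof (rule sum.mono_neutral_right)
    show "\<forall>k\<in>set (runs x w) - set (runs x w) \<inter> {..<n}. count_list (runs x w) k * k = 0"
    proof
      fix k assume "k \<in> set (runs x w) - set (runs x w) \<inter> {..<n}"
      \<comment> \<open>For \<open>k \<ge> n\<close> the allowed multiplicity is
        \<open>2 ^ 0 - 1 = 0\<close>, in accordance with \<open>x ^ n = 0\<close>.\<close>
      then have "n div (k + 1) = 0" by auto
      then show "count_list (runs x w) k * k = 0" using bound[of k] by (simp add: mult.commute)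
    qed
  qed auto
  also have "\<dots> \<le> (\<Sum>k<n. count_list (runs x w) k * k)" by (rule sum_mono2) auto
  also have "\<dots> \<le> exponent_bound n"
    unfolding exponent_bound_def by (rule sum_mono) (use bound in \<open>simp add: mult.commute\<close>)
  finally show False using assms by simp
qed

lemma sum_single_lookup:
  "(\<Sum>w\<in>Poly_Mapping.keys f. Poly_Mapping.single w (Poly_Mapping.lookup f w)) = f"
  by (rule poly_mapping_eqI) (simp add: lookup_sum lookup_single when_def in_keys_iff)

context nil_quotient
begin

text \<open>Between \<open>2 ^ q\<close> runs of length \<open>k\<close> lie at least
  \<open>2 ^ q - 1\<close> blocks. Read as letters, they form a word long enough for
  \<open>nagata_higman\<close>; the required identity is \<open>balanced_sum_mem\<close>, because
  words of larger energy already lie in \<open>J\<close>.\<close>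

lemma run_reduction:
  assumes char: "2 * CHAR('k) > n" and x: "x < d" and k: "k \<ge> 1"
    and w: "set w \<subseteq> {..<d}" "count_list (runs x w) k \<ge> 2 ^ (n div (k + 1))"
    and IH: "\<And>w'. mset w' = mset w \<Longrightarrow> run_energy x w' > run_energy x w \<Longrightarrow> word_monomial w' \<in> J"
  shows "word_monomial w \<in> J"
proof -
  define q where "q = n div (k + 1)"
  have "(2::nat) ^ q \<ge> 1" by simp
  then obtain m where m: "count_list (runs x w) k = Suc m" "m \<ge> 2 ^ q - 1"
    using w(2) unfolding q_def by (cases "count_list (runs x w) k") auto
  from runs_split[OF m(1)] obtain u bs v where
    dec: "w = u @ replicate k x @ concat (map (\<lambda>b. b @ replicate k x) bs) @ v" and
    bs: "length bs = m" "\<And>b. b \<in> set bs \<Longrightarrow> inner_word x b" and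
    uv: "u = [] \<or> last u \<noteq> x" "v = [] \<or> hd v \<noteq> x"
    by blast
  define W where "W ys = u @ replicate k x @ concat (map (\<lambda>b. b @ replicate k x) ys) @ v" for ys
  \<comment> \<open>Only rearrangements of \<open>bs\<close> keep the content and energy of \<open>w\<close>; the others are sent to 0.\<close>
  define g where "g ys = (if mset ys = mset bs then word_monomial (W ys) else 0 :: nat list \<Rightarrow>\<^sub>0 'k)" for ys
  have letters: "set u \<subseteq> {..<d}" "set v \<subseteq> {..<d}" "\<And>b. b \<in> set bs \<Longrightarrow> set b \<subseteq> {..<d}"
    using w(1) unfolding dec by (auto split: if_splits)
  have mset_W: "mset (W ys) = mset w" and energy_W: "run_energy x (W ys) = run_energy x w"
    if ys: "mset ys = mset bs" for ys
  proof -
    show "mset (W ys) = mset w"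
      using mset_concat_map_cong[OF ys, of "\<lambda>b. b @ replicate k x"] by (simp add: W_def dec)
    have "\<And>b. b \<in> set ys \<Longrightarrow> inner_word x b" using bs(2) ys by (metis set_mset_mset)
    then show "run_energy x (W ys) = run_energy x w"
      using uv bs(2) sum_list_map_cong_mset[OF ys, of "\<lambda>b. run_energy x b + k\<^sup>2"]
      by (simp add: W_def dec run_energy_pattern)
  qed
  have "sym_vanish g J q"
    unfolding sym_vanish_def
  proof (intro allI impI)
    fix y z :: "nat list list" and c :: "nat \<Rightarrow> nat list list"
    assume c: "\<forall>i<q. c i \<noteq> []"
    let ?P = "permutations_of_set {..<q}"
    obtain s0 where s0: "s0 \<in> ?P" using permutations_of_setI[of "[0..<q]" "{..<q}"]
      by (auto simp: lessThan_atLeast0)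
    let ?Y = "\<lambda>s. y @ concat (map c s) @ z"
    \<comment> \<open>Permuting the factors keeps the content, so either every \<open>g\<close> in
      the sum is 0 or every argument is a rearrangement of \<open>bs\<close>.\<close>
    have Y: "mset (?Y s) = mset (?Y s0)" if "s \<in> ?P" for s
    proof -
      have "mset s = mset s0"
        using that s0 by (metis permutations_of_setD set_eq_iff_mset_eq_distinct)
      then show ?thesis using mset_concat_map_cong[of s s0 c] by simp
    qed
    show "(\<Sum>s\<in>?P. g (?Y s)) \<in> J"
    proof (cases "mset (?Y s0) = mset bs")
      case False
      then have "(\<Sum>s\<in>?P. g (?Y s)) = 0" using Y by (intro sum.neutral) (simp add: g_def)
      then show ?thesis using zero_mem by simp
    next
      case True
      then have mem: "b \<in> set bs" if "b \<in> set (?Y s0)" for b using that by (metis set_mset_mset)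
      have c_mem: "b \<in> set bs" if "i < q" "b \<in> set (c i)" for i b
        using mem that permutations_lessThanD(2)[OF s0] by auto
      have "\<exists>a. inner_word x a \<and> concat (map (\<lambda>b. b @ replicate k x) (c i)) = a @ replicate k x"
        if "i < q" for i
        using inner_block[of "c i" x k] c c_mem[OF that] bs(2) that by metis
      then obtain a where a: "\<And>i. i < q \<Longrightarrow> inner_word x (a i)"
        "\<And>i. i < q \<Longrightarrow> concat (map (\<lambda>b. b @ replicate k x) (c i)) = a i @ replicate k x"
        by metis
      let ?u = "u @ concat (map (\<lambda>b. replicate k x @ b) y)"
      let ?v = "concat (map (\<lambda>b. b @ replicate k x) z) @ v"
      let ?W = "\<lambda>s. ?u @ replicate k x @ concat (map (\<lambda>i. a i @ replicate k x) s) @ ?v"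
      have W: "W (?Y s) = ?W s" if "s \<in> ?P" for s
      proof -
        have "concat (map (\<lambda>b. b @ replicate k x) (concat (map c s))) =
            concat (map (\<lambda>i. concat (map (\<lambda>b. b @ replicate k x) (c i))) s)"
          by (induction s) auto
        also have "\<dots> = concat (map (\<lambda>i. a i @ replicate k x) s)"
          using a(2) permutations_lessThanD(2)[OF that] by (intro arg_cong[where f = concat] map_cong) auto
        finally show ?thesis
          using concat_map_replicate_shift[of k x y] by (simp add: W_def flip: append_assoc)
      qed
      have "(\<Sum>s\<in>?P. word_monomial (?W s)) \<in> J"
      proof (rule balanced_sum_mem[OF q_def x a(1) _ _ _ _ _ s0 refl])
        show "set (a i) \<subseteq> {..<d}" if "i < q" for i
        proof -
          have "set (a i) \<subseteq> set (concat (map (\<lambda>b. b @ replicate k x) (c i)))"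
            using a(2)[OF that] by simp
          also have "\<dots> \<subseteq> insert x (\<Union>b\<in>set (c i). set b)" by (rule set_concat_padded)
          also have "\<dots> \<subseteq> {..<d}" using c_mem[OF that] letters(3) x by blast
          finally show ?thesis .
        qed
        have "set b \<subseteq> {..<d}" if "b \<in> set y \<union> set z" for b
          using that mem[of b] letters(3)[of b] by auto
        then have "insert x (\<Union>b\<in>set y. set b) \<subseteq> {..<d}" "insert x (\<Union>b\<in>set z. set b) \<subseteq> {..<d}"
          using x by blast+
        then have "set (concat (map (\<lambda>b. replicate k x @ b) y)) \<subseteq> {..<d}"
            "set (concat (map (\<lambda>b. b @ replicate k x) z)) \<subseteq> {..<d}"
          using order_trans[OF set_concat_padded(2)[of k x y]] order_trans[OF set_concat_padded(1)[of k x z]]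
          by simp_all
        then show "set ?u \<subseteq> {..<d}" "set ?v \<subseteq> {..<d}"
          using letters(1,2) by (simp_all only: set_append Un_least)
        show "?u = [] \<or> last ?u \<noteq> x"
        proof (cases y rule: rev_cases)
          case (snoc y' b)
          then have "inner_word x b" using mem bs(2) by simp
          then show ?thesis using snoc by (auto simp: inner_word_def)
        qed (use uv in simp)
        show "?v = [] \<or> hd ?v \<noteq> x"
        proof (cases z)
          case (Cons b z')
          then have "inner_word x b" using mem bs(2) by simp
          then show ?thesis using Cons by (auto simp: inner_word_def)
        qed (use uv in simp)
        show "word_monomial w' \<in> J"
          if "mset w' = mset (?W s0)" "run_energy x w' > run_energy x (?W s0)" for w'
          using that mset_W[OF True] energy_W[OF True] W[OF s0] IH by metis
      qed
      also have "(\<Sum>s\<in>?P. word_monomial (?W s)) = (\<Sum>s\<in>?P. g (?Y s))"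
      proof (rule sum.cong[OF refl])
        fix s assume s: "s \<in> ?P"
        show "word_monomial (?W s) = g (?Y s)"
          unfolding g_def W[OF s] using Y[OF s] True by simp
      qed
      finally show ?thesis .
    qed
  qed
  \<comment> \<open>The factor \<open>r + 1\<close> is invertible because
    \<open>r + 1 \<le> q \<le> n / 2 < CHAR('k)\<close>; the middle estimate uses
    \<open>k \<ge> 1\<close>.\<close>
  moreover have "f \<in> J" if "r < q" "(\<Sum>i\<le>r. f) \<in> J" for r f
  proof -
    have "n \<ge> q * 2" using k unfolding q_def by (metis div_times_less_eq_dividend le_trans mult_le_mono2 Suc_le_mono Suc_eq_plus1 one_add_one)
    then have "Suc r < CHAR('k)" using char that(1) by linarith
    then have "of_nat (Suc r) \<noteq> (0 :: 'k)"
      by (metis of_nat_eq_0_iff_char_dvd nat_dvd_not_less zero_less_Suc)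
    moreover have "Poly_Mapping.single 0 (of_nat (Suc r)) * f = (\<Sum>i\<le>r. f)"
      by (simp add: single_of_nat del: of_nat_Suc)
    ultimately show ?thesis using that(2) scalar_memD by metis
  qed
  moreover have "length bs \<ge> 2 ^ q - 1" using bs m by simp
  ultimately have "g bs \<in> J" by (rule nagata_higman[OF add_subgroup_J])
  then show ?thesis by (simp add: g_def W_def dec)
qed

text \<open>A reduction leads to rearrangements of larger energy, which have the same degree in
  \<open>x\<close>. The energy is at most the squared length, so the difference of the two serves as
  induction measure.\<close>

lemma high_degree_word_mem:
  assumes char: "2 * CHAR('k) > n" and x: "x < d"
    and "set w \<subseteq> {..<d}" "count_list w x > exponent_bound n"
  shows "word_monomial w \<in> J"
  using assms(3,4)
proof (induction "(length w)\<^sup>2 - run_energy x w" arbitrary: w rule: less_induct)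
  case less
  obtain k where k: "k \<ge> 1" "count_list (runs x w) k \<ge> 2 ^ (n div (k + 1))"
    using exists_repeated_run[OF less.prems(2)] by blast
  show ?case
  proof (rule run_reduction[OF char x k(1) less.prems(1) k(2)])
    fix w' assume w': "mset w' = mset w" "run_energy x w' > run_energy x w"
    then have "length w' = length w" "set w' = set w" "count_list w' x = count_list w x"
      by (metis size_mset, metis set_mset_mset, metis count_mset)
    moreover have "(length w')\<^sup>2 - run_energy x w' < (length w)\<^sup>2 - run_energy x w"
      using w'(2) run_energy_le[of x w'] calculation(1) by simp
    ultimately show "word_monomial w' \<in> J" using less by metis
  qed
qed

text \<open>By the pigeonhole principle, one of the \<open>d\<close> letters exceeds the degree
  bound.\<close>

lemma long_word_mem:
  assumes char: "2 * CHAR('k) > n" and w: "set w \<subseteq> {..<d}" "length w > d * exponent_bound n"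
  shows "word_monomial w \<in> J"
proof -
  have "\<exists>x<d. count_list w x > exponent_bound n"
  proof (rule ccontr)
    assume "\<not> ?thesis"
    then have "(\<Sum>x<d. count_list w x) \<le> (\<Sum>x<d. exponent_bound n)" by (intro sum_mono) (meson leI lessThan_iff)
    then show False using w sum_count_set[of w "{..<d}"] by simp
  qed
  then show ?thesis using high_degree_word_mem[OF char _ w(1)] by blast
qed

lemma long_element_mem:
  assumes char: "2 * CHAR('k) > n" and f: "f \<in> free_algebra d"
    and "\<And>w. w \<in> Poly_Mapping.keys f \<Longrightarrow> length w > d * exponent_bound n"
  shows "f \<in> J"
proof -
  have "f = (\<Sum>w\<in>Poly_Mapping.keys f. Poly_Mapping.single w (Poly_Mapping.lookup f w))"
    by (rule sum_single_lookup[symmetric])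
  moreover have "Poly_Mapping.single w (Poly_Mapping.lookup f w) \<in> J" if "w \<in> Poly_Mapping.keys f" for w
  proof -
    have "set w \<subseteq> {..<d}" using f that by (auto simp: free_algebra_def free_semigroup_def)
    then have "word_monomial w \<in> J" using long_word_mem[OF char] assms(3) that by blast
    from scalar_mem[OF this, of "Poly_Mapping.lookup f w"] show ?thesis by simp
  qed
  ultimately show ?thesis using sum_mem by metis
qed

end

subsection \<open>The relatively free algebra\<close>

lemma free_algebra_closed:
  fixes f g :: "nat list \<Rightarrow>\<^sub>0 'k::field"
  assumes "f \<in> free_algebra d" "g \<in> free_algebra d"
  shows "f + g \<in> free_algebra d" "f * g \<in> free_algebra d"
proof -
  show "f + g \<in> free_algebra d"
    using assms Poly_Mapping.keys_add[of f g] by (auto simp: free_algebra_def)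
  show "f * g \<in> free_algebra d"
    using assms keys_mult[of f g] unfolding free_algebra_def free_semigroup_def
    by (fastforce simp: plus_list_def)
qed

text \<open>This makes the algebra itself a competitor in the hull defining
  \<open>nil_ideal\<close>, which therefore stays inside the algebra.\<close>

lemma two_sided_ideal_free_algebra:
  "two_sided_ideal d (free_algebra d :: (nat list \<Rightarrow>\<^sub>0 'k::field) set)"
proof -
  have "Poly_Mapping.map ((*) c) f \<in> free_algebra d" if "f \<in> free_algebra d"
    for c and f :: "nat list \<Rightarrow>\<^sub>0 'k"
  proof -
    have "Poly_Mapping.keys (Poly_Mapping.map ((*) c) f) \<subseteq> Poly_Mapping.keys f"
      by (auto simp: in_keys_iff map.rep_eq)
    with that show ?thesis by (auto simp: free_algebra_def)
  qed
  moreover have "0 \<in> (free_algebra d :: (nat list \<Rightarrow>\<^sub>0 'k) set)" by (simp add: free_algebra_def)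
  ultimately show ?thesis unfolding two_sided_ideal_def by (auto intro: free_algebra_closed)
qed

lemma power_mem_free_algebra:
  assumes "f \<in> free_algebra d" "n \<ge> 1"
  shows "f ^ n \<in> free_algebra d"
  using assms(2,1) by (induction n rule: dec_induct) (auto intro: free_algebra_closed)

lemma nil_quotient_nil_ideal:
  fixes d :: nat
  assumes "n \<ge> 1" "infinite (UNIV :: 'k::field set)"
  shows "nil_quotient n d (nil_ideal n d :: (nat list \<Rightarrow>\<^sub>0 'k) set)"
proof
  let ?F = "{f ^ n |f. f \<in> free_algebra d} :: (nat list \<Rightarrow>\<^sub>0 'k) set"
  have free: "two_sided_ideal d (free_algebra d :: (nat list \<Rightarrow>\<^sub>0 'k) set)" "?F \<subseteq> free_algebra d"
    using two_sided_ideal_free_algebra power_mem_free_algebra assms(1) by auto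
  show "two_sided_ideal d (nil_ideal n d :: (nat list \<Rightarrow>\<^sub>0 'k) set)"
    unfolding two_sided_ideal_def
  proof (intro conjI)
    show "nil_ideal n d \<subseteq> (free_algebra d :: (nat list \<Rightarrow>\<^sub>0 'k) set)"
      unfolding nil_ideal_def using free by (intro hull_minimal) auto
  qed (unfold nil_ideal_def hull_def two_sided_ideal_def, blast+)
  show "f ^ n \<in> nil_ideal n d" if "f \<in> free_algebra d" for f :: "nat list \<Rightarrow>\<^sub>0 'k"
    unfolding nil_ideal_def using that by (intro hull_inc) auto
qed (rule assms(2))

lemma foldl_mult_mem_free_algebra:
  fixes f :: "nat list \<Rightarrow>\<^sub>0 'k::field"
  assumes "f \<in> free_algebra d" "set fs \<subseteq> free_algebra d"
  shows "foldl (*) f fs \<in> free_algebra d"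
  using assms by (induction fs arbitrary: f) (auto intro: free_algebra_closed)

text \<open>The empty word does not occur in the factors \<open>fs\<close>, so each of them adds at
  least one letter.\<close>

lemma length_keys_foldl_mult:
  fixes f :: "nat list \<Rightarrow>\<^sub>0 'k::field"
  assumes "set fs \<subseteq> free_algebra d" "\<And>w. w \<in> Poly_Mapping.keys f \<Longrightarrow> length w \<ge> m"
    "w \<in> Poly_Mapping.keys (foldl (*) f fs)"
  shows "length w \<ge> m + length fs"
  using assms
proof (induction fs arbitrary: f m)
  case (Cons g fs)
  have "length w \<ge> Suc m + length fs"
  proof (rule Cons.IH)
    fix v assume "v \<in> Poly_Mapping.keys (f * g)"
    then obtain a b where v: "v = a @ b" "a \<in> Poly_Mapping.keys f" "b \<in> Poly_Mapping.keys g"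
      using keys_mult[of f g] by (auto simp: plus_list_def)
    then have "length a \<ge> m" "b \<noteq> []"
      using Cons.prems by (auto simp: free_algebra_def free_semigroup_def)
    then show "length v \<ge> Suc m" using v(1) by (cases b) auto
  qed (use Cons.prems in auto)
  then show ?case by simp
qed simp

section \<open>Products of cosets modulo the ideal\<close>

context nil_quotient
begin

abbreviation residue_class :: "(nat list \<Rightarrow>\<^sub>0 'k) \<Rightarrow> (nat list \<Rightarrow>\<^sub>0 'k) set" where
  "residue_class f \<equiv> a_r_coset (free_ring d) J f"

lemma residue_class_eq: "residue_class f = (\<lambda>h. h + f) ` J"
  by (auto simp: a_r_coset_def' free_ring_def)

lemma residue_class_add_mem:
  assumes "h \<in> J"
  shows "residue_class (h + f) = residue_class f"
proof
  show "residue_class (h + f) \<subseteq> residue_class f"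
    using assms add_subgroup_J unfolding residue_class_eq add_subgroup_set_def
    by (auto simp flip: add.assoc)
  show "residue_class f \<subseteq> residue_class (h + f)"
    unfolding residue_class_eq
  proof (rule image_subsetI)
    fix g assume "g \<in> J"
    then have "g - h \<in> J" using assms by (rule diff_mem)
    moreover have "g + f = (g - h) + (h + f)" by simp
    ultimately show "g + f \<in> (\<lambda>g. g + (h + f)) ` J" by blast
  qed
qed

lemma residue_class_mem:
  assumes "f \<in> J"
  shows "residue_class f = J"
  using residue_class_add_mem[OF assms, of 0] by (simp add: residue_class_eq)

text \<open>The products \<open>(h + f) * (k + g)\<close> and \<open>f * g\<close> differ by an
  element of \<open>J\<close>, so all representatives give the same coset. The computation is direct
  because the \<open>one\<close> of \<open>free_ring d\<close> lies outside its carrier.\<close>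

lemma mult_residue_class:
  assumes "f \<in> free_algebra d" "g \<in> free_algebra d"
  shows "monoid.mult (free_ring d Quot J) (residue_class f) (residue_class g) = residue_class (f * g)"
proof -
  have "residue_class ((h + f) * (k + g)) = residue_class (f * g)" if "h \<in> J" "k \<in> J" for h k
  proof -
    have "h \<in> free_algebra d" "k \<in> free_algebra d"
      using ideal that unfolding two_sided_ideal_def by auto
    then have "h * k \<in> J" "h * g \<in> J" "f * k \<in> J"
      using ideal that assms unfolding two_sided_ideal_def by blast+
    then have "h * k + (h * g + f * k) \<in> J"
      using ideal unfolding two_sided_ideal_def by blast
    moreover have "(h + f) * (k + g) = (h * k + (h * g + f * k)) + f * g"
      by (simp add: algebra_simps)
    ultimately show ?thesis using residue_class_add_mem by metis
  qed
  then have "(\<Union>a\<in>residue_class f. \<Union>b\<in>residue_class g. residue_class (a * b)) = residue_class (f * g)"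
    using zero_mem unfolding residue_class_eq[of f] residue_class_eq[of g] by auto
  then show ?thesis by (simp add: FactRing_def rcoset_mult_def) (simp add: free_ring_def)
qed

lemma foldl_residue_class:
  assumes "f \<in> free_algebra d" "set fs \<subseteq> free_algebra d"
  shows "foldl (monoid.mult (free_ring d Quot J)) (residue_class f) (map residue_class fs) =
    residue_class (foldl (*) f fs)"
  using assms by (induction fs arbitrary: f) (auto simp: mult_residue_class free_algebra_closed)

text \<open>Representatives of the factors contain no empty word, so their product involves only
  words with at least \<open>d * exponent_bound n + 1\<close> letters, all of which lie in
  \<open>J\<close>.\<close>

lemma product_eq_zero:
  assumes char: "2 * CHAR('k) > n" and as: "length as = d * exponent_bound n + 1"
    and carrier: "set as \<subseteq> carrier (free_ring d Quot J)"
  shows "foldl (monoid.mult (free_ring d Quot J)) (hd as) (tl as) = zero (free_ring d Quot J)"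
proof -
  have "carrier (free_ring d Quot J) = residue_class ` free_algebra d"
    by (auto simp: FactRing_def A_RCOSETS_def') (auto simp: free_ring_def)
  with carrier have "as \<in> map residue_class ` lists (free_algebra d)"
    unfolding lists_image[symmetric] by auto
  then obtain fs where fs: "as = map residue_class fs" "set fs \<subseteq> free_algebra d" by auto
  with as obtain f gs where f: "fs = f # gs" by (cases fs) auto
  with fs have mem: "f \<in> free_algebra d" "set gs \<subseteq> free_algebra d" by auto
  have "foldl (*) f gs \<in> J"
  proof (rule long_element_mem[OF char foldl_mult_mem_free_algebra[OF mem]])
    fix w assume "w \<in> Poly_Mapping.keys (foldl (*) f gs)"
    moreover have "length v \<ge> 1" if "v \<in> Poly_Mapping.keys f" for v
      using that mem(1) by (auto simp: free_algebra_def free_semigroup_def Suc_le_eq)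
    ultimately have "length w \<ge> 1 + length gs" using length_keys_foldl_mult[OF mem(2)] by blast
    then show "length w > d * exponent_bound n" using as fs f by simp
  qed
  then have "residue_class (foldl (*) f gs) = J" by (rule residue_class_mem)
  then show ?thesis using foldl_residue_class[OF mem] by (simp add: fs f FactRing_def)
qed

end

section \<open>Bounds for the nilpotency degree\<close>

lemma nilpotency_degree_le:
  fixes n d :: nat
  assumes "n \<ge> 1" "infinite (UNIV :: 'k::field set)" "2 * CHAR('k) > n"
  shows "nilpotency_degree TYPE('k) n d \<le> enat (d * exponent_bound n + 1)"
proof -
  interpret nil_quotient n d "nil_ideal n d :: (nat list \<Rightarrow>\<^sub>0 'k) set"
    using assms(1,2) by (rule nil_quotient_nil_ideal)
  show ?thesis
    unfolding nilpotency_degree_def Let_def rel_free_algebra_def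
    by (rule Inf_lower) (use product_eq_zero[OF assms(3)] in auto)
qed

theorem corollary4p1:
  fixes n d :: nat
  assumes "n \<ge> 2" and "d \<ge> 2"
    and "infinite (UNIV :: 'k::field set)"
    and "real CHAR('k) > real n / 2"
  shows "ereal_of_enat (nilpotency_degree TYPE('k) n d)
           < ereal (4 * 2 powr (real n / 2) * real d)
         \<and> (n \<ge> 30 \<longrightarrow>
              ereal_of_enat (nilpotency_degree TYPE('k) n d)
                < ereal (2 * 2 powr (real n / 2) * real d))"
proof -
  have "2 * CHAR('k) > n" using assms(4) by linarith
  with assms have "nilpotency_degree TYPE('k) n d \<le> enat (d * exponent_bound n + 1)"
    by (intro nilpotency_degree_le) auto
  then have le: "ereal_of_enat (nilpotency_degree TYPE('k) n d) \<le> ereal (real (d * exponent_bound n + 1))"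
    by (metis ereal_of_enat_le_iff ereal_of_enat_simps(1))
  show ?thesis
  proof (intro conjI impI)
    have "real (d * exponent_bound n + 1) < real 4 * 2 powr (real n / 2) * real d"
      using exponent_bound_square(1)[OF assms(1)] assms(2) by (intro less_powr_half) auto
    with le show "ereal_of_enat (nilpotency_degree TYPE('k) n d) < ereal (4 * 2 powr (real n / 2) * real d)"
      by (auto elim: le_less_trans)
  next
    assume "n \<ge> 30"
    then have "real (d * exponent_bound n + 1) < real 2 * 2 powr (real n / 2) * real d"
      using exponent_bound_square(2) assms(2) by (intro less_powr_half) auto
    with le show "ereal_of_enat (nilpotency_degree TYPE('k) n d) < ereal (2 * 2 powr (real n / 2) * real d)"
      by (auto elim: le_less_trans)
  qed
qed

end
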